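(* For every $\epsilon>0$ there exists $c>0$ such that for all sufficiently large $n$, when playing a $b$-biased Client--Waiter game on $E(K_n)$ with $b\le (1-\epsilon)\frac{n}{2}$, Client has a strategy to create (in the graph of all edges claimed by him during the game) a minor of the complete graph $K_{c\sqrt{n}}$.
   Context: In the Client--Waiter game with integer bias $b\ge 1$ on the edge set $E(K_n)$ of the complete graph on $n$ vertices, the game proceeds in rounds. In each round Waiter offers to Client between one and $b+1$ edges of $K_n$ not previously offered by him (the number and choice being Waiter's). Client claims one edge of his choice among the edges offered, and the remaining offered edges are assigned to Waiter. The game runs until all edges of $K_n$ have been offered. Having a strategy means achieving the goal against every play of the opponent. A graph $G$ contains a graph $H$ with vertex set $\{u_1,\ldots,u_t\}$ as a minor if there are pairwise disjoint vertex subsets $V_1,\ldots,V_t$ of $G$, each spanning a (nonempty) connected subgraph of $G$, such that whenever $(u_i,u_j)$ is an edge of $H$, $G$ has an edge between $V_i$ and $V_j$. Rounding is suppressed: $K_{c\sqrt n}$ means the complete graph on $\lfloor c\sqrt n\rfloor$ vertices. *)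

theory Defs
  imports Complex_Main "HOL-Library.Ramsey"
begin

text \<open>Simple graphs are given by a vertex set and a set of two-element sets of vertices;
  \<open>nsets V 2\<close> is the edge set of the complete graph on \<open>V\<close>.\<close>

definition complete_edges :: "nat \<Rightarrow> nat set set" where
  "complete_edges n = nsets {..<n} 2"

definition spans_connected :: "'a set set \<Rightarrow> 'a set \<Rightarrow> bool" where
  "spans_connected E S \<longleftrightarrow>
     S \<noteq> {} \<and> (\<forall>x\<in>S. \<forall>y\<in>S. (x, y) \<in> {(u, v). u \<in> S \<and> v \<in> S \<and> {u, v} \<in> E}\<^sup>*)"

definition has_minor :: "'a set \<Rightarrow> 'a set set \<Rightarrow> 'b set \<Rightarrow> 'b set set \<Rightarrow> bool" where
  "has_minor V E W F \<longleftrightarrow>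
     (\<exists>B :: 'b \<Rightarrow> 'a set.
        (\<forall>u\<in>W. B u \<subseteq> V \<and> spans_connected E (B u)) \<and>
        (\<forall>u\<in>W. \<forall>v\<in>W. u \<noteq> v \<longrightarrow> B u \<inter> B v = {}) \<and>
        (\<forall>u\<in>W. \<forall>v\<in>W. {u, v} \<in> F \<longrightarrow> (\<exists>x\<in>B u. \<exists>y\<in>B v. {x, y} \<in> E)))"

text \<open>A round of the Client--Waiter game is the set of offered elements together with the
  element claimed by Client; a history lists the rounds in chronological order.  A strategy of
  Client maps the history and the current offer to the element he claims.\<close>

type_synonym 'e history = "('e set \<times> 'e) list"

type_synonym 'e client_strategy = "'e history \<Rightarrow> 'e set \<Rightarrow> 'e"

definition offered :: "'e history \<Rightarrow> 'e set" where
  "offered h = \<Union> (fst ` set h)"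

definition client_claimed :: "'e history \<Rightarrow> 'e set" where
  "client_claimed h = snd ` set h"

definition legal_strategy :: "'e client_strategy \<Rightarrow> bool" where
  "legal_strategy \<sigma> \<longleftrightarrow> (\<forall>h Q. Q \<noteq> {} \<longrightarrow> \<sigma> h Q \<in> Q)"

text \<open>The histories that can arise on the board \<open>X\<close> with bias \<open>b\<close> when Client follows \<open>\<sigma>\<close>
  and Waiter makes arbitrary legal offers.\<close>

inductive cw_play :: "nat \<Rightarrow> 'e set \<Rightarrow> 'e client_strategy \<Rightarrow> 'e history \<Rightarrow> bool"
  for b :: nat and X :: "'e set" and \<sigma> :: "'e client_strategy"
where
  start: "cw_play b X \<sigma> []"
| offer: "\<lbrakk>cw_play b X \<sigma> h; Q \<subseteq> X - offered h; 1 \<le> card Q; card Q \<le> b + 1\<rbrakk>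
    \<Longrightarrow> cw_play b X \<sigma> (h @ [(Q, \<sigma> h Q)])"

definition client_can_achieve :: "nat \<Rightarrow> 'e set \<Rightarrow> ('e set \<Rightarrow> bool) \<Rightarrow> bool" where
  "client_can_achieve b X P \<longleftrightarrow>
     (\<exists>\<sigma>. legal_strategy \<sigma> \<and>
       (\<forall>h. cw_play b X \<sigma> h \<and> offered h = X \<longrightarrow> P (client_claimed h)))"

end

theory Submission
  imports Defs "HOL-Analysis.Analysis" "HOL-Real_Asymp.Real_Asymp"
begin

text \<open>Client keeps a subgraph of his graph in which the number of bad subgraphs minus the number of
  edges is at most its expectation in the binomial random graph with edge probability
  \<open>(2 + \<epsilon>) / n\<close>: in each round one of the options ``keep one of the offered edges'' and
  ``keep none'' does not increase the conditional expectation. Bad subgraphs are large stars and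
  small sets with \<open>1 + \<delta>\<close> times as many edges as vertices. Deleting an edge of each leaves a
  graph of bounded degree with \<open>(1 + 2 * \<delta>) * n\<close> edges all of whose small vertex sets
  are sparse, and a minimal dense vertex set of such a graph spans an edge expander of linear size.

  An expander with \<open>n\<close> vertices has a clique minor of order \<open>c * sqrt n\<close>: branch sets of size
  \<open>sqrt n\<close> are chosen one at a time, after discarding vertices that spoil the expansion of the
  rest. A new branch set consists of a random walk of length about \<open>sqrt n / 2\<close> and of shortest
  paths from it to the neighbourhoods of the earlier branch sets. By the Cheeger inequality the
  walk misses a set of size \<open>m\<close> with probability \<open>exp (- \<Omega>(m / sqrt n))\<close>, and balls grow
  exponentially, so the expected length of each of these paths is bounded.\<close>

section \<open>Edge expansion and the lazy random walk\<close>

text \<open>A random choice that keeps each offered edge with probability p, and at most one per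
  round, exists only if p * (b + 1) is at most 1. For b up to (1 - \<epsilon>) * n / 2 this leaves
  room for p = (2 + \<epsilon>) / n, hence for about (1 + \<epsilon> / 2) * n edges: linearly more
  edges than vertices. This excess is what the bias condition provides. Stars have to go because the
  degree bound enters everywhere: it turns edge expansion into growth of balls and controls the
  spectral gap.

  The order sqrt n comes from two constraints. Disjointness of h branch sets of size s needs h * s =
  O(n), and a walk of length about s must come close to neighbourhoods of size about s, which needs
  s * s of order n. Joining a single vertex to each earlier branch set could cost about log n per
  path; measuring distances from a long walk removes this logarithm, as their average is bounded.
  The obstacle is that removing branch sets can ruin the expansion of the rest. Hence twice the
  needed expansion is assumed at the start, and badly attached vertices are given up.\<close>

definition edge_cut :: "'a set set \<Rightarrow> 'a set \<Rightarrow> 'a set \<Rightarrow> nat" where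
  "edge_cut E S T = card {(u, v). u \<in> S \<and> v \<in> T \<and> {u, v} \<in> E}"

lemma finite_edge_cut [simp]:
  "finite S \<Longrightarrow> finite T \<Longrightarrow> finite {(u, v). u \<in> S \<and> v \<in> T \<and> {u, v} \<in> E}"
  by (rule finite_subset[of _ "S \<times> T"]) auto

lemma edge_cut_mono: "S \<subseteq> S' \<Longrightarrow> T \<subseteq> T' \<Longrightarrow> finite S' \<Longrightarrow> finite T' \<Longrightarrow> edge_cut E S T \<le> edge_cut E S' T'"
  unfolding edge_cut_def by (intro card_mono finite_edge_cut) auto

lemma edge_cut_Un_left: "edge_cut E (S \<union> S') T \<le> edge_cut E S T + edge_cut E S' T"
proof -
  have "{(u, v). u \<in> S \<union> S' \<and> v \<in> T \<and> {u, v} \<in> E} =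
      {(u, v). u \<in> S \<and> v \<in> T \<and> {u, v} \<in> E} \<union> {(u, v). u \<in> S' \<and> v \<in> T \<and> {u, v} \<in> E}"
    by auto
  then show ?thesis unfolding edge_cut_def by (simp only: card_Un_le)
qed

lemma edge_cut_Un_right: "edge_cut E S (T \<union> T') \<le> edge_cut E S T + edge_cut E S T'"
proof -
  have "{(u, v). u \<in> S \<and> v \<in> T \<union> T' \<and> {u, v} \<in> E} =
      {(u, v). u \<in> S \<and> v \<in> T \<and> {u, v} \<in> E} \<union> {(u, v). u \<in> S \<and> v \<in> T' \<and> {u, v} \<in> E}"
    by auto
  then show ?thesis unfolding edge_cut_def by (simp only: card_Un_le)
qed

lemma edge_cut_commute: "edge_cut E S T = edge_cut E T S"
proof -
  have "{(u, v). u \<in> T \<and> v \<in> S \<and> {u, v} \<in> E} =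
      prod.swap ` {(u, v). u \<in> S \<and> v \<in> T \<and> {u, v} \<in> E}"
  proof (rule set_eqI)
    fix p :: "'a \<times> 'a"
    obtain x y where [simp]: "p = (x, y)" by (cases p)
    have "{x, y} \<in> E \<longleftrightarrow> {y, x} \<in> E" by (simp add: insert_commute)
    then show "p \<in> {(u, v). u \<in> T \<and> v \<in> S \<and> {u, v} \<in> E} \<longleftrightarrow>
        p \<in> prod.swap ` {(u, v). u \<in> S \<and> v \<in> T \<and> {u, v} \<in> E}"
      by (auto simp: image_iff)
  qed
  then show ?thesis unfolding edge_cut_def by (simp add: card_image)
qed

lemma edge_cut_le_degree:
  assumes "finite S" "finite V" "T \<subseteq> V"
    and deg: "\<And>v. v \<in> S \<Longrightarrow> real (card {u \<in> V. {u, v} \<in> E}) \<le> \<Delta>"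
  shows "real (edge_cut E S T) \<le> \<Delta> * card S"
proof -
  have eq: "{(u, v). u \<in> S \<and> v \<in> T \<and> {u, v} \<in> E} = Sigma S (\<lambda>u. {v \<in> T. {u, v} \<in> E})" by auto
  have fT: "finite T" using assms finite_subset by blast
  have "edge_cut E S T = (\<Sum>u\<in>S. card {v \<in> T. {u, v} \<in> E})"
    unfolding edge_cut_def eq by (rule card_SigmaI) (use assms(1) fT in auto)
  then have "real (edge_cut E S T) = (\<Sum>u\<in>S. real (card {v \<in> T. {u, v} \<in> E}))" by simp
  also have "\<dots> \<le> (\<Sum>u\<in>S. \<Delta>)"
  proof (rule sum_mono)
    fix u assume "u \<in> S"
    have "card {v \<in> T. {u, v} \<in> E} \<le> card {v \<in> V. {v, u} \<in> E}"
      by (rule card_mono) (use assms in \<open>auto simp: insert_commute\<close>)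
    then show "real (card {v \<in> T. {u, v} \<in> E}) \<le> \<Delta>" using deg[OF \<open>u \<in> S\<close>] by linarith
  qed
  finally show ?thesis by (simp add: mult.commute)
qed

lemma edge_cut_pos_edge:
  assumes "edge_cut E S T > 0"
  obtains u v where "u \<in> S" "v \<in> T" "{u, v} \<in> E"
proof -
  have "{(u, v). u \<in> S \<and> v \<in> T \<and> {u, v} \<in> E} \<noteq> {}"
    using assms unfolding edge_cut_def by (metis card.empty less_irrefl)
  then show ?thesis using that by auto
qed

text \<open>Degrees are counted inside \<open>R\<close>, so the locale can be interpreted on what is
  left of a larger graph. The assumption \<kappa> \<le> \<Delta> makes \<Delta> positive and
  \<open>gap\<close> at most 1/16.\<close>

locale edge_expander =
  fixes E :: "'a set set" and R :: "'a set" and \<kappa> \<Delta> :: real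
  assumes finR: "finite R" and neR: "R \<noteq> {}" and \<kappa>_pos: "\<kappa> > 0" and \<kappa>_le: "\<kappa> \<le> \<Delta>"
    and degree: "\<And>v. v \<in> R \<Longrightarrow> real (card {u \<in> R. {u, v} \<in> E}) \<le> \<Delta>"
    and expansion: "\<And>S. S \<subseteq> R \<Longrightarrow> 2 * card S \<le> card R \<Longrightarrow> \<kappa> * card S \<le> edge_cut E S (R - S)"
begin

lemma \<Delta>_pos: "\<Delta> > 0"
  using \<kappa>_pos \<kappa>_le by simp

definition nb :: "'a \<Rightarrow> 'a set" where "nb v = {u \<in> R. {u, v} \<in> E}"

lemma finite_nb [simp]: "finite (nb v)"
  unfolding nb_def using finR by auto

lemma nb_subset: "u \<in> nb v \<Longrightarrow> u \<in> R" by (simp add: nb_def)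

lemma card_nb: "v \<in> R \<Longrightarrow> real (card (nb v)) \<le> \<Delta>"
  using degree unfolding nb_def by auto

lemma sum_nb_swap: "(\<Sum>v\<in>R. \<Sum>u\<in>nb v. F u v) = (\<Sum>v\<in>R. \<Sum>u\<in>nb v. F v u)"
  for F :: "'a \<Rightarrow> 'a \<Rightarrow> real"
proof -
  have "(\<Sum>v\<in>R. \<Sum>u\<in>nb v. F u v) = (\<Sum>v\<in>R. \<Sum>u | u \<in> R \<and> {u, v} \<in> E. F u v)"
    by (simp add: nb_def)
  also have "\<dots> = (\<Sum>u\<in>R. \<Sum>v | v \<in> R \<and> {u, v} \<in> E. F u v)"
    by (rule sum.swap_restrict) (use finR in auto)
  also have "\<dots> = (\<Sum>v\<in>R. \<Sum>u\<in>nb v. F v u)"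
    by (simp add: nb_def insert_commute)
  finally show ?thesis .
qed

lemma sum_nb_le: "(\<Sum>v\<in>R. \<Sum>u\<in>nb v. h v) \<le> \<Delta> * (\<Sum>v\<in>R. h v)" if "\<And>v. v \<in> R \<Longrightarrow> h v \<ge> 0"
  for h :: "'a \<Rightarrow> real"
proof -
  have "(\<Sum>v\<in>R. \<Sum>u\<in>nb v. h v) = (\<Sum>v\<in>R. card (nb v) * h v)" by simp
  also have "\<dots> \<le> (\<Sum>v\<in>R. \<Delta> * h v)"
    by (intro sum_mono mult_right_mono card_nb that)
  finally show ?thesis by (simp add: sum_distrib_left)
qed

lemma edge_cut_eq_sum:
  assumes "S \<subseteq> R"
  shows "real (edge_cut E S (R - S)) = (\<Sum>v\<in>R. \<Sum>u\<in>nb v. if v \<in> S \<and> u \<notin> S then 1 else 0)"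
proof -
  have fS: "finite S" using assms finR finite_subset by blast
  have eq: "{(u, v). u \<in> S \<and> v \<in> R - S \<and> {u, v} \<in> E} = Sigma S (\<lambda>v. {u \<in> R - S. {v, u} \<in> E})"
    by auto
  have "edge_cut E S (R - S) = (\<Sum>v\<in>S. card {u \<in> R - S. {v, u} \<in> E})"
    unfolding edge_cut_def eq by (rule card_SigmaI) (use fS finR in auto)
  then have "real (edge_cut E S (R - S)) = (\<Sum>v\<in>S. real (card {u \<in> R - S. {v, u} \<in> E}))" by simp
  also have "\<dots> = (\<Sum>v\<in>S. \<Sum>u\<in>nb v. if v \<in> S \<and> u \<notin> S then 1 else 0)"
  proof (rule sum.cong[OF refl])
    fix v assume "v \<in> S"
    have "(\<Sum>u\<in>nb v. if v \<in> S \<and> u \<notin> S then 1 else 0) = (\<Sum>u\<in>nb v \<inter> {u. u \<notin> S}. 1::real)"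
      using \<open>v \<in> S\<close> by (simp add: sum.If_cases)
    also have "nb v \<inter> {u. u \<notin> S} = {u \<in> R - S. {v, u} \<in> E}"
      by (auto simp: nb_def insert_commute)
    finally show "real (card {u \<in> R - S. {v, u} \<in> E}) = (\<Sum>u\<in>nb v. if v \<in> S \<and> u \<notin> S then 1 else 0)"
      by simp
  qed
  also have "\<dots> = (\<Sum>v\<in>R. \<Sum>u\<in>nb v. if v \<in> S \<and> u \<notin> S then 1 else 0)"
    by (rule sum.mono_neutral_left) (use assms finR in auto)
  finally show ?thesis .
qed

text \<open>Induction on the support: peel off the lowest positive level of \<open>g\<close>.\<close>

lemma coarea:
  assumes "\<And>v. v \<in> R \<Longrightarrow> g v \<ge> 0" "2 * card {v \<in> R. g v > 0} \<le> card R"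
  shows "\<kappa> * (\<Sum>v\<in>R. g v) \<le> (\<Sum>v\<in>R. \<Sum>u\<in>nb v. max 0 (g v - g u))"
  using assms
proof (induction "card {v \<in> R. g v > 0}" arbitrary: g rule: less_induct)
  case less
  define S where "S = {v \<in> R. g v > 0}"
  have fS: "finite S" using finR by (simp add: S_def)
  show ?case
  proof (cases "S = {}")
    case True
    then have "g v = 0" if "v \<in> R" for v
      using less.prems(1)[OF that] that unfolding S_def by force
    then have "(\<Sum>v\<in>R. g v) = 0" by simp
    then show ?thesis by (simp add: sum_nonneg)
  next
    case False
    define m where "m = Min (g ` S)"
    have m_in: "m \<in> g ` S" unfolding m_def using fS False by (intro Min_in) auto
    have m_le: "m \<le> g v" if "v \<in> S" for v unfolding m_def using fS that by simp
    have m_pos: "m > 0" using m_in by (auto simp: S_def)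
    define g' where "g' = (\<lambda>v. if v \<in> S then g v - m else g v)"
    have SR: "S \<subseteq> R" by (auto simp: S_def)
    have g0: "g v = 0" if "v \<in> R" "v \<notin> S" for v
      using less.prems(1)[OF that(1)] that by (simp add: S_def)
    have nonneg: "g' v \<ge> 0" if "v \<in> R" for v
      using that m_le g0 by (auto simp: g'_def)
    have sub: "{v \<in> R. g' v > 0} \<subset> S"
    proof -
      obtain x where x: "x \<in> S" "g x = m" using m_in by auto
      have "x \<notin> {v \<in> R. g' v > 0}" using x by (simp add: g'_def)
      moreover have "{v \<in> R. g' v > 0} \<subseteq> S" using g0 by (force simp: g'_def split: if_splits)
      ultimately show ?thesis using x by blast
    qed
    have lt: "card {v \<in> R. g' v > 0} < card S" by (rule psubset_card_mono[OF fS sub])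
    have half: "2 * card {v \<in> R. g' v > 0} \<le> card R" using lt less.prems(2) unfolding S_def by linarith
    have IH: "\<kappa> * (\<Sum>v\<in>R. g' v) \<le> (\<Sum>v\<in>R. \<Sum>u\<in>nb v. max 0 (g' v - g' u))"
      using less.hyps[of g'] lt nonneg half unfolding S_def by blast
    have "(\<Sum>v\<in>R. g v) = (\<Sum>v\<in>R. g' v + (if v \<in> S then m else 0))"
      by (intro sum.cong) (auto simp: g'_def)
    also have "\<dots> = (\<Sum>v\<in>R. g' v) + m * card S"
      using finR SR by (simp add: sum.distrib sum.If_cases Int_absorb1 mult.commute)
    finally have sum_g: "(\<Sum>v\<in>R. g v) = (\<Sum>v\<in>R. g' v) + m * card S" .
    \<comment> \<open>Lowering \<open>g\<close> by \<open>m\<close> on \<open>S\<close> changes only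
      differences between \<open>S\<close> and its complement, where \<open>g\<close> is 0. Each
      such ordered pair loses exactly \<open>m\<close>, so the total loss is \<open>m\<close> times
      the boundary of \<open>S\<close>.\<close>
    have pt: "max 0 (g v - g u) = max 0 (g' v - g' u) + m * (if v \<in> S \<and> u \<notin> S then 1 else 0)"
      if "v \<in> R" "u \<in> R" for u v
    proof (cases "v \<in> S"; cases "u \<in> S")
      assume "v \<in> S" "u \<in> S"
      then show ?thesis by (simp add: g'_def)
    next
      assume "v \<in> S" "u \<notin> S"
      then show ?thesis using m_le[of v] m_pos g0[OF \<open>u \<in> R\<close>] by (simp add: g'_def max_def)
    next
      assume "v \<notin> S" "u \<in> S"
      then show ?thesis using m_le[of u] m_pos g0[OF \<open>v \<in> R\<close>] by (simp add: g'_def max_def)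
    next
      assume "v \<notin> S" "u \<notin> S"
      then show ?thesis by (simp add: g'_def)
    qed
    have "(\<Sum>v\<in>R. \<Sum>u\<in>nb v. max 0 (g v - g u)) =
        (\<Sum>v\<in>R. \<Sum>u\<in>nb v. max 0 (g' v - g' u) + m * (if v \<in> S \<and> u \<notin> S then 1 else 0))"
      by (intro sum.cong refl pt) (auto simp: nb_def)
    also have "\<dots> = (\<Sum>v\<in>R. \<Sum>u\<in>nb v. max 0 (g' v - g' u)) + m * edge_cut E S (R - S)"
      unfolding edge_cut_eq_sum[OF SR] by (simp add: sum.distrib sum_distrib_left)
    also have "\<dots> \<ge> \<kappa> * (\<Sum>v\<in>R. g' v) + m * (\<kappa> * card S)"
      using IH expansion[OF SR] less.prems(2) m_pos unfolding S_def[symmetric] by (intro add_mono mult_left_mono) auto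
    finally show ?thesis unfolding sum_g by (simp add: algebra_simps)
  qed
qed

section \<open>Cheeger and Poincare inequalities for the Dirichlet form (every edge counted in both
  directions)\<close>

definition dform :: "('a \<Rightarrow> real) \<Rightarrow> real" where
  "dform f = (\<Sum>v\<in>R. \<Sum>u\<in>nb v. (f v - f u)\<^sup>2)"

text \<open>Cheeger's argument: apply \<open>coarea\<close> to the square of \<open>g\<close>,
  factor each difference of squares, and separate the factors by a weighted AM-GM
  inequality.\<close>

lemma cheeger_half:
  assumes "\<And>v. v \<in> R \<Longrightarrow> g v \<ge> 0" "2 * card {v \<in> R. g v > 0} \<le> card R"
  shows "\<kappa>\<^sup>2 * (\<Sum>v\<in>R. (g v)\<^sup>2) \<le> 4 * \<Delta> * dform g"
proof -
  \<comment> \<open>With this weight the sum-of-squares term becomes \<kappa> / 2 times the sum of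
    the squares of \<open>g\<close>, which is absorbed into the left-hand side.\<close>
  define t where "t = 4 * \<Delta> / \<kappa>"
  have t: "t > 0" using \<kappa>_pos \<Delta>_pos by (simp add: t_def)
  have set_eq: "{v \<in> R. (g v)\<^sup>2 > 0} = {v \<in> R. g v > 0}" using assms(1) by force
  have "\<kappa> * (\<Sum>v\<in>R. (g v)\<^sup>2) \<le> (\<Sum>v\<in>R. \<Sum>u\<in>nb v. max 0 ((g v)\<^sup>2 - (g u)\<^sup>2))"
    by (rule coarea) (use assms set_eq in auto)
  also have "\<dots> \<le> (\<Sum>v\<in>R. \<Sum>u\<in>nb v. t / 2 * (g v - g u)\<^sup>2 + 1 / t * ((g v)\<^sup>2 + (g u)\<^sup>2))"
  proof (intro sum_mono)
    fix v u assume "v \<in> R" "u \<in> nb v"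
    define a where "a = g v - g u"
    define b where "b = g v + g u"
    have "0 \<le> (t * a - b)\<^sup>2" by simp
    then have "2 * t * (a * b) \<le> t\<^sup>2 * a\<^sup>2 + b\<^sup>2" by (simp add: power2_eq_square algebra_simps)
    also have "b\<^sup>2 \<le> 2 * ((g v)\<^sup>2 + (g u)\<^sup>2)"
      using sum_squares_bound[of "g v" "g u"] by (simp add: b_def power2_sum)
    finally have "a * b \<le> (t\<^sup>2 * a\<^sup>2 + 2 * ((g v)\<^sup>2 + (g u)\<^sup>2)) / (2 * t)"
      using t by (simp add: field_simps)
    also have "\<dots> = t / 2 * a\<^sup>2 + 1 / t * ((g v)\<^sup>2 + (g u)\<^sup>2)"
      using t by (simp add: field_simps power2_eq_square)
    finally have *: "a * b \<le> t / 2 * a\<^sup>2 + 1 / t * ((g v)\<^sup>2 + (g u)\<^sup>2)" .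
    moreover have "a * b = (g v)\<^sup>2 - (g u)\<^sup>2" by (simp add: a_def b_def power2_eq_square algebra_simps)
    moreover have "0 \<le> t / 2 * a\<^sup>2 + 1 / t * ((g v)\<^sup>2 + (g u)\<^sup>2)" using t by simp
    ultimately show "max 0 ((g v)\<^sup>2 - (g u)\<^sup>2) \<le> t / 2 * (g v - g u)\<^sup>2 + 1 / t * ((g v)\<^sup>2 + (g u)\<^sup>2)"
      by (simp add: a_def)
  qed
  also have "\<dots> = t / 2 * dform g + 1 / t * ((\<Sum>v\<in>R. \<Sum>u\<in>nb v. (g v)\<^sup>2) + (\<Sum>v\<in>R. \<Sum>u\<in>nb v. (g u)\<^sup>2))"
    unfolding dform_def by (simp only: sum.distrib sum_distrib_left distrib_left)
  also have "(\<Sum>v\<in>R. \<Sum>u\<in>nb v. (g u)\<^sup>2) = (\<Sum>v\<in>R. \<Sum>u\<in>nb v. (g v)\<^sup>2)"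
    by (rule sum_nb_swap)
  also have "t / 2 * dform g + 1 / t * ((\<Sum>v\<in>R. \<Sum>u\<in>nb v. (g v)\<^sup>2) + (\<Sum>v\<in>R. \<Sum>u\<in>nb v. (g v)\<^sup>2)) \<le>
      t / 2 * dform g + 1 / t * (2 * (\<Delta> * (\<Sum>v\<in>R. (g v)\<^sup>2)))"
    using sum_nb_le[of "\<lambda>v. (g v)\<^sup>2"] t by (intro add_left_mono mult_left_mono) auto
  also have "\<dots> = 2 * \<Delta> / \<kappa> * dform g + \<kappa> / 2 * (\<Sum>v\<in>R. (g v)\<^sup>2)"
    using \<Delta>_pos \<kappa>_pos by (simp add: t_def field_simps)
  finally have "\<kappa> / 2 * (\<Sum>v\<in>R. (g v)\<^sup>2) \<le> 2 * \<Delta> / \<kappa> * dform g" by linarith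
  then have "2 * \<kappa> * (\<kappa> / 2 * (\<Sum>v\<in>R. (g v)\<^sup>2)) \<le> 2 * \<kappa> * (2 * \<Delta> / \<kappa> * dform g)"
    using \<kappa>_pos by (intro mult_left_mono) auto
  then show ?thesis using \<kappa>_pos by (simp add: power2_eq_square algebra_simps)
qed

lemma median_exists:
  fixes f :: "'a \<Rightarrow> real"
  obtains m where "2 * card {x \<in> R. f x > m} \<le> card R" "2 * card {x \<in> R. f x < m} \<le> card R"
proof -
  \<comment> \<open>The median is the least value of \<open>f\<close> with at most half of
    \<open>R\<close> strictly above it. The next smaller value violates this condition, so at most
    half of \<open>R\<close> lies below.\<close>
  define Y where "Y = {y \<in> f ` R. 2 * card {x \<in> R. f x > y} \<le> card R}"
  have fY: "finite Y" using finR by (simp add: Y_def)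
  have "Max (f ` R) \<in> Y"
  proof -
    have "{x \<in> R. f x > Max (f ` R)} = {}" using finR by (auto simp: not_less)
    then show ?thesis unfolding Y_def using finR neR by (simp only: mem_Collect_eq card.empty) (auto intro: Max_in)
  qed
  then have neY: "Y \<noteq> {}" by auto
  define m where "m = Min Y"
  have mY: "m \<in> Y" unfolding m_def using fY neY by simp
  have "2 * card {x \<in> R. f x < m} \<le> card R"
  proof (cases "{x \<in> R. f x < m} = {}")
    case True then show ?thesis by (simp only: card.empty)
  next
    case False
    define y where "y = Max (f ` {x \<in> R. f x < m})"
    have y: "y \<in> f ` {x \<in> R. f x < m}" unfolding y_def using False finR by (intro Max_in) auto
    have yle: "f x \<le> y" if "x \<in> R" "f x < m" for x
      unfolding y_def using that finR by (intro Max_ge) auto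
    have "y < m" using y by auto
    then have "y \<notin> Y" using fY unfolding m_def by (meson Min_le not_less)
    then have big: "2 * card {x \<in> R. f x > y} > card R" using y unfolding Y_def by auto
    have "{x \<in> R. f x < m} = R - {x \<in> R. f x > y}" using yle \<open>y < m\<close> by force
    then have "card {x \<in> R. f x < m} = card R - card {x \<in> R. f x > y}"
      using finR by (simp add: card_Diff_subset)
    then show ?thesis using big by linarith
  qed
  with mY show ?thesis using that unfolding Y_def by auto
qed

text \<open>About a median, the positive and negative parts of \<open>f - m\<close> each live on at
  most half of \<open>R\<close>, so \<open>cheeger_half\<close> applies to both. Their Dirichlet
  forms add up to at most that of \<open>f\<close>.\<close>

lemma poincare:
  obtains m where "\<kappa>\<^sup>2 * (\<Sum>v\<in>R. (f v - m)\<^sup>2) \<le> 4 * \<Delta> * dform f"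
proof -
  obtain m where m: "2 * card {x \<in> R. f x > m} \<le> card R" "2 * card {x \<in> R. f x < m} \<le> card R"
    by (rule median_exists)
  define g where "g = (\<lambda>v. max 0 (f v - m))"
  define g' where "g' = (\<lambda>v. max 0 (m - f v))"
  have 1: "\<kappa>\<^sup>2 * (\<Sum>v\<in>R. (g v)\<^sup>2) \<le> 4 * \<Delta> * dform g"
  proof (rule cheeger_half)
    have "{v \<in> R. g v > 0} = {v \<in> R. f v > m}" by (auto simp: g_def)
    then show "2 * card {v \<in> R. g v > 0} \<le> card R" using m by simp
  qed (simp add: g_def)
  have 2: "\<kappa>\<^sup>2 * (\<Sum>v\<in>R. (g' v)\<^sup>2) \<le> 4 * \<Delta> * dform g'"
  proof (rule cheeger_half)
    have "{v \<in> R. g' v > 0} = {v \<in> R. f v < m}" by (auto simp: g'_def)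
    then show "2 * card {v \<in> R. g' v > 0} \<le> card R" using m by simp
  qed (simp add: g'_def)
  have pt: "(g v - g u)\<^sup>2 + (g' v - g' u)\<^sup>2 \<le> (f v - f u)\<^sup>2" for u v
  proof -
    have *: "a\<^sup>2 + b\<^sup>2 \<le> (a + b)\<^sup>2" if "a \<ge> 0" "b \<ge> 0" for a b :: real
      using that by (simp add: power2_sum)
    consider "f v \<ge> m" "f u \<ge> m" | "f v \<ge> m" "f u \<le> m" | "f v \<le> m" "f u \<ge> m" | "f v \<le> m" "f u \<le> m"
      by linarith
    then show ?thesis
    proof cases
      case 2
      then show ?thesis using *[of "f v - m" "m - f u"] by (simp add: g_def g'_def power2_commute[of m])
    next
      case 3
      then show ?thesis using *[of "f u - m" "m - f v"] by (simp add: g_def g'_def power2_commute[of m] power2_commute[of "f v" "f u"])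
    qed (simp_all add: g_def g'_def power2_commute)
  qed
  have "dform g + dform g' \<le> dform f"
    unfolding dform_def sum.distrib[symmetric] by (intro sum_mono pt)
  then have "4 * \<Delta> * (dform g + dform g') \<le> 4 * \<Delta> * dform f"
    using \<Delta>_pos by (intro mult_left_mono) auto
  moreover have "(\<Sum>v\<in>R. (f v - m)\<^sup>2) = (\<Sum>v\<in>R. (g v)\<^sup>2) + (\<Sum>v\<in>R. (g' v)\<^sup>2)"
    unfolding sum.distrib[symmetric]
    by (intro sum.cong refl) (auto simp: g_def g'_def max_def power2_commute)
  ultimately have "\<kappa>\<^sup>2 * (\<Sum>v\<in>R. (f v - m)\<^sup>2) \<le> 4 * \<Delta> * dform f"
    using 1 2 by (simp add: algebra_simps)
  then show ?thesis by (rule that)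
qed

lemma dirichlet_bound:
  assumes "U \<subseteq> R" "\<And>v. v \<in> U \<Longrightarrow> f v = 0"
  shows "\<kappa>\<^sup>2 * card U / card R * (\<Sum>v\<in>R. (f v)\<^sup>2) \<le> 4 * \<Delta> * dform f"
proof -
  obtain m where m: "\<kappa>\<^sup>2 * (\<Sum>v\<in>R. (f v - m)\<^sup>2) \<le> 4 * \<Delta> * dform f" by (rule poincare)
  define N where "N = real (card R)"
  have N: "N > 0" using finR neR by (simp add: N_def card_gt_0_iff)
  define s where "s = (\<Sum>v\<in>R. f v)"
  define q where "q = (\<Sum>v\<in>R. (f v)\<^sup>2)"
  have "s = (\<Sum>v\<in>R - U. f v)" unfolding s_def
    by (rule sum.mono_neutral_right) (use finR assms in auto)
  then have "s\<^sup>2 \<le> (\<Sum>v\<in>R - U. (f v)\<^sup>2) * (\<Sum>v\<in>R - U. 1\<^sup>2)"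
    using Cauchy_Schwarz_ineq_sum[of f "\<lambda>_. 1" "R - U"] by simp
  also have "(\<Sum>v\<in>R - U. (f v)\<^sup>2) = q" unfolding q_def
    by (rule sum.mono_neutral_left) (use finR assms in auto)
  also have "(\<Sum>v\<in>R - U. 1\<^sup>2) = N - card U"
    using assms finR by (simp add: N_def card_Diff_subset finite_subset card_mono of_nat_diff)
  finally have cs: "s\<^sup>2 \<le> q * (N - card U)" .
  have "(\<Sum>v\<in>R. (f v - m)\<^sup>2) = (\<Sum>v\<in>R. (f v)\<^sup>2 - 2 * m * f v + m\<^sup>2)"
    by (intro sum.cong) (auto simp: power2_eq_square algebra_simps)
  also have "\<dots> = q - 2 * m * s + N * m\<^sup>2"
    by (simp add: sum.distrib sum_subtractf sum_distrib_left q_def s_def N_def)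
  finally have e: "(\<Sum>v\<in>R. (f v - m)\<^sup>2) = q - 2 * m * s + N * m\<^sup>2" .
  \<comment> \<open>The squared deviation is least at the mean \<open>s / N\<close>; this square
    expresses that without dividing.\<close>
  have "0 \<le> (N * m - s)\<^sup>2" by simp
  then have "N * (q - 2 * m * s + N * m\<^sup>2) \<ge> N * q - s\<^sup>2"
    by (simp add: power2_eq_square algebra_simps)
  then have "N * (q - 2 * m * s + N * m\<^sup>2) \<ge> card U * q" using cs by (simp add: algebra_simps)
  then have "card U / N * q \<le> (\<Sum>v\<in>R. (f v - m)\<^sup>2)"
    unfolding e using N by (simp add: field_simps)
  then have "\<kappa>\<^sup>2 * (card U / N * q) \<le> \<kappa>\<^sup>2 * (\<Sum>v\<in>R. (f v - m)\<^sup>2)"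
    by (intro mult_left_mono) auto
  then show ?thesis using m unfolding q_def N_def by simp
qed

section \<open>The lazy random walk and its escape from sets\<close>

text \<open>The walk moves along each incident edge with probability 1 / (2 * \<Delta>), not 1 / (2
  * degree). It is therefore symmetric for the counting measure and no stationary weights appear,
  even though degrees vary.\<close>

definition lazy :: "('a \<Rightarrow> real) \<Rightarrow> 'a \<Rightarrow> real" where
  "lazy f v = f v + (\<Sum>u\<in>nb v. f u - f v) / (2 * \<Delta>)"

text \<open>Expand the square. Symmetrising the inner product of \<open>f\<close> with its Laplacian
  \<open>L\<close> gives a first-order loss of \<open>dform f / (2 * \<Delta>)\<close>;
  Cauchy-Schwarz bounds the second-order gain by half of that, thanks to laziness.\<close>

lemma lazy_norm: "(\<Sum>v\<in>R. (lazy f v)\<^sup>2) \<le> (\<Sum>v\<in>R. (f v)\<^sup>2) - dform f / (4 * \<Delta>)"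
proof -
  define L where "L = (\<lambda>v. \<Sum>u\<in>nb v. f u - f v)"
  have lz: "(lazy f v)\<^sup>2 = (f v)\<^sup>2 + f v * L v / \<Delta> + (L v)\<^sup>2 / (4 * \<Delta>\<^sup>2)" for v
  proof -
    have "lazy f v = f v + L v / (2 * \<Delta>)" by (simp add: lazy_def L_def)
    show ?thesis unfolding \<open>lazy f v = f v + L v / (2 * \<Delta>)\<close> using \<Delta>_pos
      by (simp add: power2_eq_square field_simps)
  qed
  have "(\<Sum>v\<in>R. f v * L v) = (\<Sum>v\<in>R. \<Sum>u\<in>nb v. f v * (f u - f v))"
    by (simp add: L_def sum_distrib_left)
  moreover have "\<dots> = (\<Sum>v\<in>R. \<Sum>u\<in>nb v. f u * (f v - f u))"
    by (rule sum_nb_swap)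
  moreover have "(\<Sum>v\<in>R. \<Sum>u\<in>nb v. f v * (f u - f v)) + (\<Sum>v\<in>R. \<Sum>u\<in>nb v. f u * (f v - f u)) = - dform f"
    unfolding dform_def sum.distrib[symmetric] sum_negf[symmetric]
    by (intro sum.cong refl) (simp add: power2_eq_square algebra_simps)
  ultimately have fL: "(\<Sum>v\<in>R. f v * L v) = - dform f / 2" by simp
  have LL: "(\<Sum>v\<in>R. (L v)\<^sup>2) \<le> \<Delta> * dform f"
    unfolding dform_def sum_distrib_left[of \<Delta>]
  proof (rule sum_mono)
    fix v assume v: "v \<in> R"
    have "(L v)\<^sup>2 \<le> (\<Sum>u\<in>nb v. (f u - f v)\<^sup>2) * (\<Sum>u\<in>nb v. 1\<^sup>2)"
      using Cauchy_Schwarz_ineq_sum[of "\<lambda>u. f u - f v" "\<lambda>_. 1" "nb v"] by (simp add: L_def)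
    also have "\<dots> \<le> (\<Sum>u\<in>nb v. (f u - f v)\<^sup>2) * \<Delta>"
      using card_nb[OF v] by (intro mult_left_mono) (auto simp: sum_nonneg)
    also have "\<dots> = (\<Sum>u\<in>nb v. \<Delta> * (f v - f u)\<^sup>2)"
      by (simp add: sum_distrib_left power2_commute mult.commute)
    finally show "(L v)\<^sup>2 \<le> (\<Sum>u\<in>nb v. \<Delta> * (f v - f u)\<^sup>2)" .
  qed
  have "(\<Sum>v\<in>R. (lazy f v)\<^sup>2) = (\<Sum>v\<in>R. (f v)\<^sup>2) + (\<Sum>v\<in>R. f v * L v) / \<Delta> + (\<Sum>v\<in>R. (L v)\<^sup>2) / (4 * \<Delta>\<^sup>2)"
    unfolding lz by (simp add: sum.distrib sum_divide_distrib)
  also have "\<dots> \<le> (\<Sum>v\<in>R. (f v)\<^sup>2) + (- dform f / 2) / \<Delta> + (\<Delta> * dform f) / (4 * \<Delta>\<^sup>2)"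
    unfolding fL using LL \<Delta>_pos by (intro add_left_mono divide_right_mono) auto
  also have "\<dots> = (\<Sum>v\<in>R. (f v)\<^sup>2) - dform f / (4 * \<Delta>)"
    using \<Delta>_pos by (simp add: field_simps power2_eq_square)
  finally show ?thesis .
qed

text \<open>\<open>lazy f v\<close> is a convex combination of the values of \<open>f\<close> at
  \<open>v\<close> and its neighbours, so one of them is no larger. This replaces a random step by a
  chosen one.\<close>

lemma lazy_ge_some:
  assumes "v \<in> R"
  shows "\<exists>u \<in> insert v (nb v). f u \<le> lazy f v"
proof (rule ccontr)
  assume "\<not> ?thesis"
  then have *: "f u > lazy f v" if "u \<in> insert v (nb v)" for u using that by force
  have "(\<Sum>u\<in>nb v. f u - f v) \<ge> (\<Sum>u\<in>nb v. lazy f v - f v)"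
    by (intro sum_mono) (use * in force)
  moreover have "(\<Sum>u\<in>nb v. lazy f v - f v) = card (nb v) * (lazy f v - f v)" by simp
  moreover have "card (nb v) * (lazy f v - f v) \<ge> \<Delta> * (lazy f v - f v)"
    using card_nb[OF assms] *[of v] by (intro mult_right_mono_neg) auto
  ultimately have "(\<Sum>u\<in>nb v. f u - f v) / (2 * \<Delta>) \<ge> \<Delta> * (lazy f v - f v) / (2 * \<Delta>)"
    using \<Delta>_pos by (intro divide_right_mono) auto
  also have "\<Delta> * (lazy f v - f v) / (2 * \<Delta>) = (lazy f v - f v) / 2" using \<Delta>_pos by simp
  finally have "lazy f v - f v \<ge> (lazy f v - f v) / 2" by (simp add: lazy_def)
  then show False using *[of v] by simp
qed

lemma lazy_sum: "lazy (\<lambda>u. \<Sum>i\<in>I. f i u) v = (\<Sum>i\<in>I. lazy (f i) v)"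
proof -
  have "(\<Sum>u\<in>nb v. (\<Sum>i\<in>I. f i u) - (\<Sum>i\<in>I. f i v)) = (\<Sum>i\<in>I. \<Sum>u\<in>nb v. f i u - f i v)"
    unfolding sum_subtractf[symmetric] by (rule sum.swap)
  then show ?thesis by (simp add: lazy_def sum.distrib sum_divide_distrib)
qed

text \<open>\<open>stay A k v\<close> is the probability that \<open>k\<close> steps of the lazy random walk from \<open>v\<close> stay
  in \<open>A\<close>.\<close>

primrec stay :: "'a set \<Rightarrow> nat \<Rightarrow> 'a \<Rightarrow> real" where
  "stay A 0 v = (if v \<in> A then 1 else 0)"
| "stay A (Suc k) v = (if v \<in> A then lazy (stay A k) v else 0)"

lemma stay_outside: "v \<notin> A \<Longrightarrow> stay A k v = 0"
  by (cases k) auto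

text \<open>The factor \<kappa>^2 / (4 * \<Delta>) of \<open>dirichlet_bound\<close> times the
  factor 1 / (4 * \<Delta>) of \<open>lazy_norm\<close>.\<close>

definition gap :: real where "gap = \<kappa>\<^sup>2 / (16 * \<Delta>\<^sup>2)"

text \<open>Killing the walk on \<open>U\<close> only lowers the norm, and \<open>lazy_norm\<close>
  with \<open>dirichlet_bound\<close> contracts it at each step. The second conjunct is recorded
  because later estimates raise the base to powers.\<close>

lemma stay_sq:
  assumes "U \<subseteq> R"
  shows "(\<Sum>v\<in>R. (stay (R - U) k v)\<^sup>2) \<le> card R * (1 - gap * card U / card R) ^ k
    \<and> 0 \<le> (1 - gap * card U / card R)"
proof -
  define \<rho> where "\<rho> = 1 - gap * card U / card R"
  have step: "(\<Sum>v\<in>R. (stay (R - U) (Suc k) v)\<^sup>2) \<le> \<rho> * (\<Sum>v\<in>R. (stay (R - U) k v)\<^sup>2)" for k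
  proof -
    let ?f = "stay (R - U) k"
    have "(\<Sum>v\<in>R. (stay (R - U) (Suc k) v)\<^sup>2) \<le> (\<Sum>v\<in>R. (lazy ?f v)\<^sup>2)"
      by (intro sum_mono) auto
    also have "\<dots> \<le> (\<Sum>v\<in>R. (?f v)\<^sup>2) - dform ?f / (4 * \<Delta>)" by (rule lazy_norm)
    also have "\<dots> \<le> (\<Sum>v\<in>R. (?f v)\<^sup>2) - (\<kappa>\<^sup>2 * card U / card R * (\<Sum>v\<in>R. (?f v)\<^sup>2) / (4 * \<Delta>)) / (4 * \<Delta>)"
    proof -
      have "\<kappa>\<^sup>2 * card U / card R * (\<Sum>v\<in>R. (?f v)\<^sup>2) \<le> 4 * \<Delta> * dform ?f"
        by (rule dirichlet_bound) (use assms stay_outside in auto)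
      then have "\<kappa>\<^sup>2 * card U / card R * (\<Sum>v\<in>R. (?f v)\<^sup>2) / (4 * \<Delta>) \<le> dform ?f"
        using \<Delta>_pos by (subst pos_divide_le_eq) (simp_all add: mult.commute)
      then show ?thesis using \<Delta>_pos by (intro diff_left_mono divide_right_mono) auto
    qed
    also have "\<dots> = \<rho> * (\<Sum>v\<in>R. (?f v)\<^sup>2)"
      unfolding \<rho>_def gap_def by (simp add: power2_eq_square algebra_simps)
    finally show ?thesis .
  qed
  have cR: "card R > 0" using finR neR by (simp add: card_gt_0_iff)
  have "\<rho> \<ge> 0"
  proof -
    have "\<kappa>\<^sup>2 \<le> \<Delta>\<^sup>2" using \<kappa>_pos \<kappa>_le by (intro power_mono) auto
    then have "\<kappa>\<^sup>2 \<le> 16 * \<Delta>\<^sup>2" using zero_le_power2[of \<Delta>] by linarith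
    then have "gap \<le> 1" using \<Delta>_pos by (simp add: gap_def)
    moreover have "real (card U) \<le> card R" using assms finR by (simp add: card_mono)
    moreover have "gap \<ge> 0" by (simp add: gap_def)
    ultimately have "gap * real (card U) \<le> 1 * real (card R)" by (intro mult_mono) auto
    then show ?thesis using cR by (simp add: \<rho>_def divide_le_eq)
  qed
  have "(\<Sum>v\<in>R. (stay (R - U) k v)\<^sup>2) \<le> card R * \<rho> ^ k"
  proof (induction k)
    case 0
    have "(\<Sum>v\<in>R. (stay (R - U) 0 v)\<^sup>2) \<le> (\<Sum>v\<in>R. 1)" by (intro sum_mono) auto
    then show ?case by simp
  next
    case (Suc k)
    have "\<rho> * (\<Sum>v\<in>R. (stay (R - U) k v)\<^sup>2) \<le> \<rho> * (card R * \<rho> ^ k)"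
      using Suc \<open>\<rho> \<ge> 0\<close> by (rule mult_left_mono)
    then show ?case using step[of k] by (simp add: algebra_simps)
  qed
  with \<open>\<rho> \<ge> 0\<close> show ?thesis by (simp add: \<rho>_def)
qed

end

section \<open>Connected sets meeting many given sets\<close>

lemma spans_connected_singleton: "spans_connected E {v}"
  by (simp add: spans_connected_def)

lemma spans_connected_insert:
  assumes T: "spans_connected E T" and x: "x \<in> T" and e: "{v, x} \<in> E"
  shows "spans_connected E (insert v T)"
proof -
  define r where "r = {(a, b). a \<in> insert v T \<and> b \<in> insert v T \<and> {a, b} \<in> E}"
  have sub: "{(a, b). a \<in> T \<and> b \<in> T \<and> {a, b} \<in> E} \<subseteq> r" by (auto simp: r_def)
  have T': "(a, b) \<in> r\<^sup>*" if "a \<in> T" "b \<in> T" for a b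
    using T that rtrancl_mono[OF sub] unfolding spans_connected_def by blast
  have vx: "(v, x) \<in> r" using x e by (auto simp: r_def)
  have xv: "(x, v) \<in> r" using x e by (auto simp: r_def insert_commute)
  have "(a, b) \<in> r\<^sup>*" if "a \<in> insert v T" "b \<in> insert v T" for a b
  proof -
    have "(a, x) \<in> r\<^sup>*" using that(1) T' x vx by blast
    moreover have "(x, b) \<in> r\<^sup>*" using that(2) T' x xv by blast
    ultimately show ?thesis by (rule rtrancl_trans)
  qed
  then show ?thesis unfolding spans_connected_def r_def by auto
qed

context edge_expander
begin

text \<open>Expansion is applied to the smaller of \<open>S\<close> and \<open>R - S\<close>; in
  particular an expander is connected.\<close>

lemma edge_cut_lower:
  assumes "S \<subseteq> R" "S \<noteq> {}" "S \<noteq> R"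
  shows "edge_cut E S (R - S) > 0"
proof (cases "2 * card S \<le> card R")
  case True
  have "card S > 0" using assms finR by (meson card_gt_0_iff finite_subset)
  then have "\<kappa> * card S > 0" using \<kappa>_pos by simp
  then show ?thesis using expansion[OF assms(1) True] by linarith
next
  case False
  have c: "card (R - S) = card R - card S" using assms finR by (simp add: card_Diff_subset finite_subset)
  then have "2 * card (R - S) \<le> card R" using False by linarith
  then have "\<kappa> * card (R - S) \<le> edge_cut E (R - S) (R - (R - S))" by (intro expansion) auto
  moreover have "card (R - S) > 0" using assms finR by (auto simp: card_gt_0_iff)
  then have "\<kappa> * card (R - S) > 0" using \<kappa>_pos by simp
  moreover have "R - (R - S) = S" using assms by auto
  ultimately show ?thesis by (simp add: edge_cut_commute)
qed

lemma connected_extend: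
  assumes "T \<subseteq> R" "spans_connected E T" "card T \<le> s" "s \<le> card R"
  shows "\<exists>T'. T \<subseteq> T' \<and> T' \<subseteq> R \<and> spans_connected E T' \<and> card T' = s"
  using assms
proof (induction "s - card T" arbitrary: T)
  case 0
  then show ?case by (intro exI[of _ T]) auto
next
  case (Suc k)
  have fT: "finite T" using Suc.prems finR finite_subset by blast
  have "T \<noteq> R" using Suc by auto
  moreover have "T \<noteq> {}" using Suc.prems by (simp add: spans_connected_def)
  ultimately have "edge_cut E T (R - T) > 0" using Suc.prems by (intro edge_cut_lower)
  then obtain u v where uv: "u \<in> T" "v \<in> R - T" "{u, v} \<in> E" by (rule edge_cut_pos_edge)
  have "spans_connected E (insert v T)"
    by (rule spans_connected_insert[OF _ uv(1)]) (use Suc.prems uv in \<open>auto simp: insert_commute\<close>)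
  moreover have "card (insert v T) = Suc (card T)" using uv fT by simp
  ultimately have "\<exists>T'. insert v T \<subseteq> T' \<and> T' \<subseteq> R \<and> spans_connected E T' \<and> card T' = s"
    using Suc uv by (intro Suc.hyps(1)) auto
  then show ?case by blast
qed

text \<open>Derandomised form of: a lazy random walk from \<open>v\<close> stays in \<open>A i\<close> for, on average,
  \<open>\<Sum>i\<in>I. stay (A i) k v\<close> of the indices \<open>i\<close>.\<close>

lemma walk_exists:
  assumes "finite I" "v \<in> R"
  shows "\<exists>T. v \<in> T \<and> T \<subseteq> R \<and> spans_connected E T \<and> card T \<le> Suc k \<and>
    real (card {i \<in> I. T \<subseteq> A i}) \<le> (\<Sum>i\<in>I. stay (A i) k v)"
  using assms
proof (induction k arbitrary: I v)
  case 0
  have "(\<Sum>i\<in>I. stay (A i) 0 v) = card {i \<in> I. v \<in> A i}"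
    using 0 by (simp add: sum.If_cases Int_def)
  then show ?case using 0 by (intro exI[of _ "{v}"]) (simp add: spans_connected_singleton)
next
  case (Suc k)
  \<comment> \<open>Only the indices whose set contains \<open>v\<close> can still survive;
    \<open>f\<close> is the expected number of survivors after moving on to a given vertex.\<close>
  define I' where "I' = {i \<in> I. v \<in> A i}"
  have fI': "finite I'" using Suc.prems by (simp add: I'_def)
  define f where "f = (\<lambda>u. \<Sum>i\<in>I'. stay (A i) k u)"
  obtain u where u: "u \<in> insert v (nb v)" "f u \<le> lazy f v"
    using lazy_ge_some[OF Suc.prems(2)] by blast
  have uR: "u \<in> R" using u Suc.prems nb_subset by auto
  obtain T where T: "u \<in> T" "T \<subseteq> R" "spans_connected E T" "card T \<le> Suc k"
      "real (card {i \<in> I'. T \<subseteq> A i}) \<le> (\<Sum>i\<in>I'. stay (A i) k u)"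
    using Suc.IH[OF fI' uR] by blast
  have fT: "finite T" using T finR finite_subset by blast
  have "spans_connected E (insert v T)"
  proof (cases "u = v")
    case True then show ?thesis using T by (simp add: insert_absorb)
  next
    case False
    then have "{u, v} \<in> E" using u by (auto simp: nb_def)
    then show ?thesis using T by (intro spans_connected_insert[of _ _ u]) (auto simp: insert_commute)
  qed
  moreover have "card (insert v T) \<le> Suc (Suc k)"
    using T(4) fT by (simp add: card_insert_if)
  moreover have "{i \<in> I. insert v T \<subseteq> A i} = {i \<in> I'. T \<subseteq> A i}" by (auto simp: I'_def)
  moreover have "(\<Sum>i\<in>I. stay (A i) (Suc k) v) = lazy f v"
  proof -
    have "(\<Sum>i\<in>I. stay (A i) (Suc k) v) = (\<Sum>i\<in>I'. lazy (stay (A i) k) v)"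
      using Suc.prems unfolding I'_def by (simp add: sum.inter_filter)
    then show ?thesis unfolding f_def lazy_sum .
  qed
  ultimately show ?case using T u Suc.prems
    by (intro exI[of _ "insert v T"]) (auto simp: f_def)
qed

text \<open>Cauchy-Schwarz passes from the sum of squares to the plain sum and halves the exponent,
  which is why the walk takes \<open>2 * j\<close> steps.\<close>

lemma stay_sum:
  assumes "U \<subseteq> R"
  shows "(\<Sum>v\<in>R. stay (R - U) (2 * j) v) \<le> card R * exp (- (gap * card U * j / card R))"
proof -
  define \<rho> where "\<rho> = 1 - gap * card U / card R"
  note * = stay_sq[OF assms, of "2 * j", folded \<rho>_def]
  have "(\<Sum>v\<in>R. stay (R - U) (2 * j) v)\<^sup>2 \<le> (\<Sum>v\<in>R. (stay (R - U) (2 * j) v)\<^sup>2) * (\<Sum>v\<in>R. 1\<^sup>2)"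
    using Cauchy_Schwarz_ineq_sum[of "stay (R - U) (2 * j)" "\<lambda>_. 1" R] by simp
  also have "\<dots> \<le> (card R * \<rho> ^ (2 * j)) * card R"
    using * by (simp add: mult_right_mono)
  also have "\<dots> = (card R * \<rho> ^ j)\<^sup>2" by (simp add: power2_eq_square power_mult_distrib mult_2 power_add)
  finally have "(\<Sum>v\<in>R. stay (R - U) (2 * j) v) \<le> card R * \<rho> ^ j"
    by (rule power2_le_imp_le) (use * in simp)
  also have "\<rho> ^ j \<le> exp (- (gap * card U / card R)) ^ j"
    using * exp_ge_add_one_self[of "- (gap * card U / card R)"] unfolding \<rho>_def by (intro power_mono) auto
  also have "exp (- (gap * card U / card R)) ^ j = exp (- (gap * card U * j / card R))"
    by (simp add: exp_of_nat_mult[symmetric] mult.commute)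
  finally show ?thesis by (simp add: mult_left_mono)
qed

text \<open>The starting vertex is averaged over \<open>R\<close> as well, and a best one is fixed
  before \<open>walk_exists\<close> fixes the steps.\<close>

lemma walk_misses_few:
  assumes "finite I" "\<And>i. i \<in> I \<Longrightarrow> U i \<subseteq> R"
  shows "\<exists>T. T \<subseteq> R \<and> spans_connected E T \<and> card T \<le> 2 * j + 1 \<and>
    real (card {i \<in> I. T \<inter> U i = {}}) \<le> (\<Sum>i\<in>I. exp (- (gap * card (U i) * j / card R)))"
proof -
  define b where "b = (\<Sum>i\<in>I. exp (- (gap * card (U i) * j / card R)))"
  have "(\<Sum>v\<in>R. \<Sum>i\<in>I. stay (R - U i) (2 * j) v) = (\<Sum>i\<in>I. \<Sum>v\<in>R. stay (R - U i) (2 * j) v)"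
    by (rule sum.swap)
  also have "\<dots> \<le> (\<Sum>i\<in>I. card R * exp (- (gap * card (U i) * j / card R)))"
    by (intro sum_mono stay_sum assms)
  also have "\<dots> = (\<Sum>v\<in>R. b)" by (simp add: b_def sum_distrib_left)
  finally have "\<exists>v\<in>R. (\<Sum>i\<in>I. stay (R - U i) (2 * j) v) \<le> b"
    using sum_strict_mono[OF finR neR, of "\<lambda>_. b" "\<lambda>v. \<Sum>i\<in>I. stay (R - U i) (2 * j) v"]
    by (meson not_less)
  then obtain v where v: "v \<in> R" "(\<Sum>i\<in>I. stay (R - U i) (2 * j) v) \<le> b" by blast
  obtain T where T: "T \<subseteq> R" "spans_connected E T" "card T \<le> Suc (2 * j)"
      "real (card {i \<in> I. T \<subseteq> R - U i}) \<le> (\<Sum>i\<in>I. stay (R - U i) (2 * j) v)"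
    using walk_exists[OF assms(1) v(1), of "2 * j" "\<lambda>i. R - U i"] by blast
  have "{i \<in> I. T \<subseteq> R - U i} = {i \<in> I. T \<inter> U i = {}}" using T(1) by auto
  then show ?thesis using T v b_def by (intro exI[of _ T]) auto
qed

section \<open>Growth of balls and connecting paths\<close>

primrec nball :: "'a set \<Rightarrow> nat \<Rightarrow> 'a set" where
  "nball U 0 = U"
| "nball U (Suc r) = nball U r \<union> {v \<in> R. \<exists>u\<in>nball U r. {u, v} \<in> E}"

lemma nball_subset: "U \<subseteq> R \<Longrightarrow> nball U r \<subseteq> R"
  by (induction r) auto

lemma nball_mono: "r \<le> r' \<Longrightarrow> nball U r \<subseteq> nball U r'"
  by (rule lift_Suc_mono_le[of "nball U"]) auto

text \<open>All edges leaving the ball end in the next layer, and each vertex there receives at most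
  \<Delta> of them.\<close>

lemma nball_grow:
  assumes "U \<subseteq> R" "2 * card (nball U r) \<le> card R"
  shows "(1 + \<kappa> / \<Delta>) * card (nball U r) \<le> card (nball U (Suc r))"
proof -
  let ?B = "nball U r"
  let ?N = "nball U (Suc r) - ?B"
  have B: "?B \<subseteq> R" and B': "nball U (Suc r) \<subseteq> R" using nball_subset[OF assms(1)] by blast+
  have fB: "finite ?B" "finite (nball U (Suc r))" using B B' finR finite_subset by blast+
  have "\<kappa> * card ?B \<le> edge_cut E ?B (R - ?B)" by (rule expansion[OF B assms(2)])
  also have "edge_cut E ?B (R - ?B) = edge_cut E ?B ?N"
    unfolding edge_cut_def by (rule arg_cong[where f = card]) (use B in auto)
  also have "\<dots> = edge_cut E ?N ?B" by (rule edge_cut_commute)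
  also have "real (edge_cut E ?N ?B) \<le> \<Delta> * card ?N"
    by (rule edge_cut_le_degree[where V = R]) (use fB B B' finR degree in auto)
  finally have "\<kappa> / \<Delta> * card ?B \<le> card ?N" using \<Delta>_pos by (simp add: field_simps)
  moreover have "card ?N = card (nball U (Suc r)) - card ?B"
    by (rule card_Diff_subset) (use fB in auto)
  moreover have "card ?B \<le> card (nball U (Suc r))" by (rule card_mono) (use fB in auto)
  ultimately show ?thesis by (simp add: algebra_simps of_nat_diff)
qed

lemma nball_card:
  assumes "U \<subseteq> R"
  shows "min (card U * (1 + \<kappa> / \<Delta>) ^ r) (card R / 2) \<le> card (nball U r)"
proof (induction r)
  case 0
  then show ?case by simp
next
  case (Suc r)
  have le: "card (nball U r) \<le> card (nball U (Suc r))"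
    by (rule card_mono) (use nball_subset[OF assms, of "Suc r"] finR finite_subset in auto)
  have a: "\<kappa> / \<Delta> > 0" using \<kappa>_pos \<Delta>_pos by simp
  show ?case
  proof (cases "2 * card (nball U r) \<le> card R")
    case False
    then have "real (card R) / 2 \<le> card (nball U r)" by linarith
    then show ?thesis using le by linarith
  next
    case True
    have "min (card U * (1 + \<kappa> / \<Delta>) ^ Suc r) (card R / 2) \<le>
        (1 + \<kappa> / \<Delta>) * min (card U * (1 + \<kappa> / \<Delta>) ^ r) (card R / 2)"
    proof -
      have "real (card R) / 2 \<le> (1 + \<kappa> / \<Delta>) * (card R / 2)"
        using mult_right_mono[of 1 "1 + \<kappa> / \<Delta>" "card R / 2"] a by simp
      moreover have "card U * (1 + \<kappa> / \<Delta>) ^ Suc r = (1 + \<kappa> / \<Delta>) * (card U * (1 + \<kappa> / \<Delta>) ^ r)"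
        by simp
      ultimately show ?thesis
        by (cases "card U * (1 + \<kappa> / \<Delta>) ^ r \<le> card R / 2")
           (simp_all only: min_absorb1 min_absorb2 linear min.coboundedI1 min.coboundedI2 order_refl not_le less_imp_le)
    qed
    also have "\<dots> \<le> (1 + \<kappa> / \<Delta>) * card (nball U r)" using Suc a by (intro mult_left_mono) auto
    also have "\<dots> \<le> card (nball U (Suc r))" by (rule nball_grow[OF assms True])
    finally show ?thesis .
  qed
qed

text \<open>Beyond half of \<open>R\<close> geometric growth is no longer guaranteed, but
  connectedness still adds a vertex at every radius. This makes all distances in
  \<open>hit_all\<close> smaller than \<open>card R\<close>.\<close>

lemma nball_full:
  assumes "U \<subseteq> R" "U \<noteq> {}"
  shows "nball U (card R) = R"
proof -
  have *: "min (card R) (Suc r) \<le> card (nball U r)" for r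
  proof (induction r)
    case 0
    have "card U > 0" using assms finR by (meson card_gt_0_iff finite_subset)
    then show ?case by simp
  next
    case (Suc r)
    have B: "nball U r \<subseteq> R" and B': "nball U (Suc r) \<subseteq> R" using nball_subset[OF assms(1)] by blast+
    have fB': "finite (nball U (Suc r))" using B' finR finite_subset by blast
    show ?case
    proof (cases "nball U r = R")
      case True
      then have "nball U (Suc r) = R" using B' by auto
      then show ?thesis by simp
    next
      case False
      have "U \<subseteq> nball U r" using nball_mono[of 0 r U] by simp
      then have "nball U r \<noteq> {}" using assms by blast
      with False B have "edge_cut E (nball U r) (R - nball U r) > 0" by (intro edge_cut_lower)
      then obtain u v where "u \<in> nball U r" "v \<in> R - nball U r" "{u, v} \<in> E" by (rule edge_cut_pos_edge)
      then have "nball U r \<subset> nball U (Suc r)" by auto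
      then have "card (nball U r) < card (nball U (Suc r))" using fB' by (rule psubset_card_mono[rotated])
      then show ?thesis using Suc by linarith
    qed
  qed
  have "card R \<le> card (nball U (card R))" using *[of "card R"] by simp
  with finR nball_subset[OF assms(1)] show ?thesis by (rule card_seteq)
qed

text \<open>Go back through the layers towards \<open>U\<close>, adding at most one vertex per unit
  of radius.\<close>

lemma nball_path:
  assumes "U \<subseteq> R" "T \<subseteq> R" "spans_connected E T" "T \<inter> nball U r \<noteq> {}"
  shows "\<exists>T'. T \<subseteq> T' \<and> T' \<subseteq> R \<and> spans_connected E T' \<and> T' \<inter> U \<noteq> {} \<and> card T' \<le> card T + r"
  using assms(2-)
proof (induction r arbitrary: T)
  case 0
  then show ?case by (intro exI[of _ T]) auto
next
  case (Suc r)
  have fT: "finite T" using Suc.prems finR finite_subset by blast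
  show ?case
  proof (cases "T \<inter> nball U r = {}")
    case False
    then obtain T' where "T \<subseteq> T'" "T' \<subseteq> R" "spans_connected E T'" "T' \<inter> U \<noteq> {}" "card T' \<le> card T + r"
      using Suc.IH[OF Suc.prems(1,2) False] by blast
    then show ?thesis by (intro exI[of _ T']) auto
  next
    case True
    obtain x where "x \<in> T" "x \<in> nball U (Suc r)" using Suc.prems(3) by blast
    with True obtain u where x: "x \<in> T" "u \<in> nball U r" "{u, x} \<in> E" by auto
    have uR: "u \<in> R" using x nball_subset[OF assms(1)] by blast
    have "spans_connected E (insert u T)"
      by (rule spans_connected_insert[OF Suc.prems(2) x(1,3)])
    moreover have sub: "insert u T \<subseteq> R" using uR Suc.prems(1) by blast
    moreover have hit: "insert u T \<inter> nball U r \<noteq> {}" using x(2) by blast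
    ultimately obtain T' where "insert u T \<subseteq> T'" "T' \<subseteq> R" "spans_connected E T'" "T' \<inter> U \<noteq> {}"
        "card T' \<le> card (insert u T) + r"
      using Suc.IH[of "insert u T"] sub hit by blast
    moreover have "card (insert u T) \<le> Suc (card T)" using fT by (simp add: card_insert_if)
    ultimately show ?thesis by (intro exI[of _ T']) auto
  qed
qed

lemma connect_all:
  assumes "finite J" "\<And>j. j \<in> J \<Longrightarrow> U j \<subseteq> R" "\<And>j. j \<in> J \<Longrightarrow> T \<inter> nball (U j) (d j) \<noteq> {}"
    and "T \<subseteq> R" "spans_connected E T"
  shows "\<exists>T'. T \<subseteq> T' \<and> T' \<subseteq> R \<and> spans_connected E T' \<and> (\<forall>j\<in>J. T' \<inter> U j \<noteq> {}) \<and>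
    card T' \<le> card T + (\<Sum>j\<in>J. d j)"
  using assms
proof (induction J rule: finite_induct)
  case empty
  then show ?case by (intro exI[of _ T]) auto
next
  case (insert j J)
  then obtain T' where T': "T \<subseteq> T'" "T' \<subseteq> R" "spans_connected E T'" "\<forall>j\<in>J. T' \<inter> U j \<noteq> {}"
      "card T' \<le> card T + (\<Sum>j\<in>J. d j)"
    by auto
  have "T' \<inter> nball (U j) (d j) \<noteq> {}" using insert.prems(2)[of j] T' by blast
  then obtain T'' where "T' \<subseteq> T''" "T'' \<subseteq> R" "spans_connected E T''" "T'' \<inter> U j \<noteq> {}"
      "card T'' \<le> card T' + d j"
    using nball_path[of "U j" T' "d j"] T' insert.prems(1)[of j] by auto
  moreover from this T' have "\<forall>i\<in>insert j J. T'' \<inter> U i \<noteq> {}" by blast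
  ultimately show ?case using T' insert.hyps by (intro exI[of _ T'']) auto
qed

text \<open>The number of radii for which the walk misses the ball around \<open>U j\<close> is its distance
  from \<open>U j\<close>.\<close>

lemma hit_all:
  fixes k :: nat
  assumes J: "finite J" and U: "\<And>j. j \<in> J \<Longrightarrow> U j \<subseteq> R" "\<And>j. j \<in> J \<Longrightarrow> U j \<noteq> {}"
  shows "\<exists>T. T \<subseteq> R \<and> spans_connected E T \<and> (\<forall>j\<in>J. T \<inter> U j \<noteq> {}) \<and>
    real (card T) \<le> 2 * k + 1 +
      (\<Sum>j\<in>J. \<Sum>r<card R. exp (- (gap * card (nball (U j) r) * k / card R)))"
proof -
  \<comment> \<open>A single walk is derandomised against all balls of all radii at once.\<close>
  let ?I = "J \<times> {..<card R}"
  have "\<And>i. i \<in> ?I \<Longrightarrow> (case i of (j, r) \<Rightarrow> nball (U j) r) \<subseteq> R"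
    using nball_subset[OF U(1)] by blast
  then obtain T where T: "T \<subseteq> R" "spans_connected E T" "card T \<le> 2 * k + 1"
      "real (card {i \<in> ?I. T \<inter> (case i of (j, r) \<Rightarrow> nball (U j) r) = {}}) \<le>
        (\<Sum>i\<in>?I. exp (- (gap * card (case i of (j, r) \<Rightarrow> nball (U j) r) * k / card R)))"
    using walk_misses_few[of ?I "\<lambda>i. case i of (j, r) \<Rightarrow> nball (U j) r" k] J by auto
  define d where "d = (\<lambda>j. card {r \<in> {..<card R}. T \<inter> nball (U j) r = {}})"
  \<comment> \<open>Balls are nested, so missing radius \<open>d j\<close> would mean missing all of
    the \<open>d j + 1\<close> radii from 0 to \<open>d j\<close>, one more than \<open>d j\<close>
    counts.\<close>
  have hit: "T \<inter> nball (U j) (d j) \<noteq> {}" if j: "j \<in> J" for j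
  proof
    assume emp: "T \<inter> nball (U j) (d j) = {}"
    have "T \<noteq> {}" using T by (simp add: spans_connected_def)
    then have "T \<inter> nball (U j) (card R) \<noteq> {}" using nball_full[OF U[OF j]] T by auto
    then have "d j < card R" using emp nball_mono[of "card R" "d j" "U j"] by (cases "d j < card R") auto
    then have "{..d j} \<subseteq> {r \<in> {..<card R}. T \<inter> nball (U j) r = {}}"
      using emp nball_mono[of _ "d j" "U j"] by fastforce
    then have "card {..d j} \<le> d j" unfolding d_def by (intro card_mono) auto
    then show False by simp
  qed
  obtain T' where T': "T \<subseteq> T'" "T' \<subseteq> R" "spans_connected E T'" "\<forall>j\<in>J. T' \<inter> U j \<noteq> {}"
      "card T' \<le> card T + (\<Sum>j\<in>J. d j)"
    using connect_all[where U = U and d = d, OF J U(1) hit T(1,2)] by blast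
  have "{i \<in> ?I. T \<inter> (case i of (j, r) \<Rightarrow> nball (U j) r) = {}} =
      Sigma J (\<lambda>j. {r \<in> {..<card R}. T \<inter> nball (U j) r = {}})" by auto
  then have "card {i \<in> ?I. T \<inter> (case i of (j, r) \<Rightarrow> nball (U j) r) = {}} = (\<Sum>j\<in>J. d j)"
    using J by (simp add: d_def)
  moreover have "(\<Sum>i\<in>?I. exp (- (gap * card (case i of (j, r) \<Rightarrow> nball (U j) r) * k / card R))) =
      (\<Sum>j\<in>J. \<Sum>r<card R. exp (- (gap * card (nball (U j) r) * k / card R)))"
    by (simp add: sum.cartesian_product case_prod_unfold)
  ultimately have "real (\<Sum>j\<in>J. d j) \<le>
      (\<Sum>j\<in>J. \<Sum>r<card R. exp (- (gap * card (nball (U j) r) * k / card R)))"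
    using T(4) by (simp only:)
  moreover have "real (card T') \<le> real (2 * k + 1) + real (\<Sum>j\<in>J. d j)"
    using T'(5) T(3) by linarith
  ultimately have "real (card T') \<le> 2 * k + 1 +
      (\<Sum>j\<in>J. \<Sum>r<card R. exp (- (gap * card (nball (U j) r) * k / card R)))" by simp
  then show ?thesis using T' by (intro exI[of _ T']) auto
qed

text \<open>This bounds the expected distance from the walk to \<open>U\<close>. While balls grow
  geometrically, \<open>exp (- y)\<close> \<le> \<open>1 / y\<close> gives a geometric series with
  sum at most 1 + \<Delta> / \<kappa>; once a ball fills half of \<open>R\<close>, its term is at
  most \<open>exp (- (gap * k / 2))\<close>. If \<open>card U\<close> and \<open>k\<close> are both
  of order the square root of \<open>card R\<close>, the first part is bounded.\<close>

lemma exp_ball_sum: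
  fixes k :: nat
  assumes U: "U \<subseteq> R" "U \<noteq> {}" and k: "k > 0"
  shows "(\<Sum>r<card R. exp (- (gap * card (nball U r) * k / card R))) \<le>
    card R * (1 + \<Delta> / \<kappa>) / (gap * card U * k) + card R * exp (- (gap * k / 2))"
proof -
  define a where "a = \<kappa> / \<Delta>"
  define N where "N = real (card R)"
  have a: "a > 0" using \<kappa>_pos \<Delta>_pos by (simp add: a_def)
  have N: "N > 0" using finR neR by (simp add: N_def card_gt_0_iff)
  have g: "gap > 0" using \<kappa>_pos \<Delta>_pos by (simp add: gap_def)
  have cU: "card U > 0" using U finR by (meson card_gt_0_iff finite_subset)
  define x where "x = gap * card U * k / N"
  have x: "x > 0" using g cU N k by (simp add: x_def)
  have pt: "exp (- (gap * card (nball U r) * k / N)) \<le> (1 / x) * (1 / (1 + a)) ^ r + exp (- (gap * k / 2))" for r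
  proof -
    consider "card U * (1 + a) ^ r \<le> card (nball U r)" | "N / 2 \<le> card (nball U r)"
      using nball_card[OF U(1), of r] unfolding a_def N_def by linarith
    then show ?thesis
    proof cases
      case 1
      define y where "y = gap * card (nball U r) * k / N"
      have "x * (1 + a) ^ r = gap * (card U * (1 + a) ^ r) * k / N" by (simp add: x_def)
      also have "\<dots> \<le> y"
        unfolding y_def using 1 g N by (intro divide_right_mono mult_right_mono mult_left_mono) auto
      finally have y: "x * (1 + a) ^ r \<le> y" .
      have pos: "x * (1 + a) ^ r > 0" using x a by simp
      have "exp (- y) \<le> 1 / y"
      proof -
        have "y \<le> exp y" using exp_ge_add_one_self[of y] by linarith
        then have "1 / exp y \<le> 1 / y" using y pos by (intro divide_left_mono) auto
        then show ?thesis by (simp add: exp_minus inverse_eq_divide)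
      qed
      also have "\<dots> \<le> 1 / (x * (1 + a) ^ r)" using y pos by (intro frac_le) auto
      also have "\<dots> = (1 / x) * (1 / (1 + a)) ^ r" by (simp add: power_one_over)
      finally show ?thesis using exp_ge_zero[of "- (gap * k / 2)"] unfolding y_def by linarith
    next
      case 2
      have "gap * k / 2 = gap * (N / 2) * k / N" using N by simp
      also have "\<dots> \<le> gap * card (nball U r) * k / N"
        using 2 g N by (intro divide_right_mono mult_right_mono mult_left_mono) auto
      finally have "exp (- (gap * card (nball U r) * k / N)) \<le> exp (- (gap * k / 2))" by simp
      moreover have "(1 / x) * (1 / (1 + a)) ^ r \<ge> 0" using x a by simp
      ultimately show ?thesis by linarith
    qed
  qed
  have "(\<Sum>r<card R. exp (- (gap * card (nball U r) * k / N))) \<le>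
      (\<Sum>r<card R. (1 / x) * (1 / (1 + a)) ^ r + exp (- (gap * k / 2)))"
    by (intro sum_mono pt)
  also have "\<dots> = (1 / x) * (\<Sum>r<card R. (1 / (1 + a)) ^ r) + N * exp (- (gap * k / 2))"
    by (simp add: sum.distrib sum_distrib_left N_def)
  also have "(1 / x) * (\<Sum>r<card R. (1 / (1 + a)) ^ r) \<le> (1 / x) * (1 + \<Delta> / \<kappa>)"
  proof (rule mult_left_mono)
    have "(\<Sum>r<card R. (1 / (1 + a)) ^ r) \<le> (\<Sum>r. (1 / (1 + a)) ^ r)"
      using a by (intro sum_le_suminf summable_geometric) auto
    also have "(\<Sum>r. (1 / (1 + a)) ^ r) = 1 / (1 - 1 / (1 + a))"
      using a by (intro suminf_geometric) auto
    also have "\<dots> = 1 + \<Delta> / \<kappa>" using a \<kappa>_pos \<Delta>_pos by (simp add: a_def field_simps)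
    finally show "(\<Sum>r<card R. (1 / (1 + a)) ^ r) \<le> 1 + \<Delta> / \<kappa>" .
  qed (use x in simp)
  also have "(1 / x) * (1 + \<Delta> / \<kappa>) = N * (1 + \<Delta> / \<kappa>) / (gap * card U * k)"
    by (simp add: x_def)
  finally show ?thesis by (simp add: N_def)
qed

end

section \<open>Clique minors in expanders\<close>

definition touching :: "'a set set \<Rightarrow> 'a set \<Rightarrow> 'a set \<Rightarrow> bool" where
  "touching E B B' \<longleftrightarrow> B \<inter> B' = {} \<and> (\<exists>x\<in>B. \<exists>y\<in>B'. {x, y} \<in> E)"

lemma touching_commute: "touching E B B' \<longleftrightarrow> touching E B' B"
proof -
  have "touching E B' B" if t: "touching E B B'" for B B'
  proof -
    obtain x y where "x \<in> B" "y \<in> B'" "{x, y} \<in> E" using t unfolding touching_def by blast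
    moreover from this have "{y, x} \<in> E" by (simp add: insert_commute)
    moreover have "B' \<inter> B = {}" using t by (auto simp: touching_def)
    ultimately show ?thesis unfolding touching_def by blast
  qed
  then show ?thesis by blast
qed

text \<open>\<open>h\<close> branch sets of size \<open>s\<close> fit into \<open>n\<close> vertices, and \<open>s\<close> leaves room for a walk of
  length \<open>2 k\<close> together with the expected length of its connections to \<open>h\<close> branch sets.\<close>

definition size_ok :: "real \<Rightarrow> real \<Rightarrow> nat \<Rightarrow> nat \<Rightarrow> nat \<Rightarrow> nat \<Rightarrow> bool" where
  "size_ok \<kappa> \<Delta> n h s k \<longleftrightarrow> k > 0 \<and> s > 0 \<and> 8 * \<Delta> * real (h * s) \<le> \<kappa> * real n \<and>
    2 * real k + 1 + real h * (real n * (1 + \<Delta> / \<kappa>) / (\<kappa>\<^sup>2 / (16 * \<Delta>\<^sup>2) * (\<kappa> * real s / \<Delta>) * real k) +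
       real n * exp (- (\<kappa>\<^sup>2 / (16 * \<Delta>\<^sup>2) * real k / 2))) \<le> real s"

text \<open>Compared with \<open>edge_expander\<close>, the expansion is doubled and holds up to
  three quarters of \<open>V\<close>. The surplus pays for the edges into branch sets, and the wider
  range leaves room to add half of the remaining vertices to the discarded ones.\<close>

locale strong_expander =
  fixes E :: "'a set set" and V :: "'a set" and \<kappa> \<Delta> :: real and s h k :: nat
  assumes finV: "finite V" and neV: "V \<noteq> {}" and \<kappa>_pos: "\<kappa> > 0" and \<kappa>_le: "\<kappa> \<le> \<Delta>"
    and degree: "\<And>v. v \<in> V \<Longrightarrow> real (card {u \<in> V. {u, v} \<in> E}) \<le> \<Delta>"
    and expansion: "\<And>S. S \<subseteq> V \<Longrightarrow> 4 * card S \<le> 3 * card V \<Longrightarrow> 2 * \<kappa> * card S \<le> edge_cut E S (V - S)"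
    and h_pos: "h > 0" and size: "size_ok \<kappa> \<Delta> (card V) h s k"
begin

lemma k_pos: "k > 0" and s_pos: "s > 0" and hs: "8 * \<Delta> * (h * s) \<le> \<kappa> * card V"
  using size by (auto simp: size_ok_def)

lemma \<Delta>_pos: "\<Delta> > 0"
  using \<kappa>_pos \<kappa>_le by simp

text \<open>\<open>BB\<close> is a family of branch sets found so far, \<open>D\<close> a set of vertices that
  have been discarded since it expands badly into the rest.\<close>

definition config :: "'a set \<Rightarrow> 'a set set \<Rightarrow> bool" where
  "config D BB \<longleftrightarrow> D \<subseteq> V \<and> finite BB \<and> card BB \<le> h \<and>
    (\<forall>B\<in>BB. B \<subseteq> V - D \<and> card B = s \<and> spans_connected E B) \<and>
    pairwise (touching E) BB \<and>
    8 * card D \<le> card V \<and> edge_cut E D (V - D - \<Union>BB) \<le> \<kappa> * card D"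

lemma hs_nat: "8 * (h * s) \<le> card V"
proof -
  have "\<kappa> * card V \<le> \<Delta> * card V" using \<kappa>_le by (intro mult_right_mono) auto
  then have "\<Delta> * (8 * (h * s)) \<le> \<Delta> * card V" using hs by (simp add: algebra_simps)
  then have "real (8 * (h * s)) \<le> card V" using \<Delta>_pos by simp
  then show ?thesis by linarith
qed

lemma s_le: "8 * s \<le> card V"
proof -
  have "1 * s \<le> h * s" using h_pos by (intro mult_right_mono) auto
  then show ?thesis using hs_nat by linarith
qed

lemma card_Union_le: "config D BB \<Longrightarrow> card (\<Union>BB) \<le> h * s"
proof -
  assume c: "config D BB"
  have "card (\<Union>BB) \<le> (\<Sum>B\<in>BB. card B)" by (rule card_Union_le_sum_card)
  also have "\<dots> = card BB * s" using c by (simp add: config_def)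
  also have "\<dots> \<le> h * s" using c by (simp add: config_def)
  finally show ?thesis .
qed

text \<open>\<open>D\<close> has at least \<open>2 * \<kappa> * card D\<close> outgoing edges, so at
  least half of them must enter \<open>W\<close>, which has at most \<Delta> * h * s edge ends. Thus
  a badly expanding set below three quarters of \<open>V\<close> is already below one eighth, and
  the discarded set stays small however often it is enlarged.\<close>

lemma discard:
  assumes D: "D \<subseteq> V" "W \<subseteq> V" "card W \<le> h * s" "4 * card D \<le> 3 * card V"
    and c: "edge_cut E D (V - D - W) \<le> \<kappa> * card D"
  shows "8 * card D \<le> card V"
proof -
  have fin: "finite D" "finite W" using D finV finite_subset by auto
  have "2 * \<kappa> * card D \<le> edge_cut E D (V - D)" by (rule expansion[OF D(1,4)])
  also have "edge_cut E D (V - D) \<le> edge_cut E D ((V - D - W) \<union> W)"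
    by (rule edge_cut_mono) (use fin finV in auto)
  also have "\<dots> \<le> edge_cut E D (V - D - W) + edge_cut E D W" by (rule edge_cut_Un_right)
  also have "edge_cut E D W = edge_cut E W D" by (rule edge_cut_commute)
  also have "real (edge_cut E D (V - D - W) + edge_cut E W D) \<le> \<kappa> * card D + \<Delta> * card W"
  proof -
    have "real (edge_cut E W D) \<le> \<Delta> * card W"
      by (rule edge_cut_le_degree[where V = V]) (use fin D finV degree in auto)
    then show ?thesis using c by simp
  qed
  finally have "\<kappa> * card D \<le> \<Delta> * card W" by (simp add: algebra_simps)
  also have "\<dots> \<le> \<Delta> * (h * s)" using D(3) \<Delta>_pos by (intro mult_left_mono) (auto simp flip: of_nat_mult)
  also have "\<dots> \<le> \<kappa> * card V / 8" using hs by simp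
  finally have "\<kappa> * (8 * card D) \<le> \<kappa> * card V" by simp
  then have "real (8 * card D) \<le> card V" using \<kappa>_pos by simp
  then show ?thesis by linarith
qed

text \<open>Take a configuration with the most discarded vertices and, among those, the most branch
  sets. Maximality of \<open>D\<close> forces the remainder to expand and every branch set to have
  many neighbours in it; then \<open>hit_all\<close> would supply one more branch set if there were
  fewer than \<open>h\<close>.\<close>

lemma branch_sets:
  "\<exists>BB. finite BB \<and> card BB = h \<and> (\<forall>B\<in>BB. B \<subseteq> V \<and> spans_connected E B) \<and>
    pairwise (touching E) BB"
proof -
  let ?P = "\<lambda>p. config (fst p) (snd p)"
  \<comment> \<open>Lexicographic order in one number: as \<open>card BB\<close> is at most
    \<open>h\<close>, one more discarded vertex outweighs the loss of any number of branch
    sets.\<close>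
  let ?m = "\<lambda>p. card (fst p) * Suc h + card (snd p)"
  have "config {} {}" by (simp add: config_def edge_cut_def)
  then have "?P ({}, {})" by simp
  moreover have "?m p < card V * Suc h + Suc h" if "?P p" for p
  proof -
    have "card (fst p) \<le> card V" using that finV by (auto simp: config_def intro: card_mono)
    moreover have "card (snd p) \<le> h" using that by (simp add: config_def)
    ultimately show ?thesis by (meson add_le_less_mono le_imp_less_Suc mult_le_mono1)
  qed
  ultimately obtain p where p: "?P p" and pmax: "\<And>q. ?P q \<Longrightarrow> ?m q \<le> ?m p"
    using ex_has_greatest_nat[of ?P "({}, {})" ?m "card V * Suc h + Suc h"] by blast
  obtain D BB where pD: "p = (D, BB)" by (cases p)
  have cfg: "config D BB" using p pD by simp
  have max: "card D' * Suc h + card BB' \<le> card D * Suc h + card BB" if "config D' BB'" for D' BB'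
    using pmax[of "(D', BB')"] that pD by simp
  have maxD: "card D' \<le> card D" if "config D' BB'" for D' BB'
  proof (rule ccontr)
    assume "\<not> card D' \<le> card D"
    then have "Suc (card D) * Suc h \<le> card D' * Suc h" by (intro mult_right_mono) auto
    moreover have "card BB \<le> h" using cfg by (simp add: config_def)
    ultimately show False using max[OF that] by simp
  qed
  note cD = cfg[unfolded config_def]
  have fD: "finite D" using cD finV finite_subset by blast
  have fBB: "finite BB" using cD by blast
  have BV: "B \<subseteq> V" "card B = s" "spans_connected E B" "B \<inter> D = {}" if "B \<in> BB" for B using cD that by auto
  have fB: "finite B" if "B \<in> BB" for B using BV(1)[OF that] finV finite_subset by blast
  have UV: "\<Union>BB \<subseteq> V" using BV by blast
  have card_U: "card (\<Union>BB) \<le> h * s" by (rule card_Union_le[OF cfg])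
  show ?thesis
  proof (cases "card BB = h")
    case True
    then show ?thesis using cD by (intro exI[of _ BB]) auto
  next
    case False
    define R where "R = V - D - \<Union>BB"
    have RV: "R \<subseteq> V" by (auto simp: R_def)
    have fR: "finite R" using RV finV finite_subset by blast
    have "card V \<le> card (R \<union> (D \<union> \<Union>BB))" by (rule card_mono) (use fR fD fB fBB R_def in auto)
    also have "\<dots> \<le> card R + card (D \<union> \<Union>BB)" by (rule card_Un_le)
    also have "card (D \<union> \<Union>BB) \<le> card D + card (\<Union>BB)" by (rule card_Un_le)
    \<comment> \<open>One eighth of \<open>V\<close> at most is discarded and one eighth at most is
      covered by branch sets.\<close>
    finally have cardR: "3 * card V \<le> 4 * card R"
      using cD card_U hs_nat by linarith
    have cV: "card V > 0" using finV neV by (simp add: card_gt_0_iff)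
    have neR: "R \<noteq> {}" using cardR cV by auto
    interpret X: edge_expander E R \<kappa> \<Delta>
    proof
      fix v assume v: "v \<in> R"
      have "card {u \<in> R. {u, v} \<in> E} \<le> card {u \<in> V. {u, v} \<in> E}"
        by (rule card_mono) (use finV RV in auto)
      moreover have "real (card {u \<in> V. {u, v} \<in> E}) \<le> \<Delta>" using v RV by (intro degree) auto
      ultimately show "real (card {u \<in> R. {u, v} \<in> E}) \<le> \<Delta>" by linarith
    next
      fix S assume S: "S \<subseteq> R" "2 * card S \<le> card R"
      \<comment> \<open>Otherwise \<open>S\<close> could be discarded too, against the maximality of
        \<open>D\<close>.\<close>
      show "\<kappa> * card S \<le> edge_cut E S (R - S)"
      proof (rule ccontr)
        assume "\<not> ?thesis"
        then have lt: "edge_cut E S (R - S) < \<kappa> * card S" by simp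
        have fS: "finite S" using S fR finite_subset by blast
        have disj: "D \<inter> S = {}" using S by (auto simp: R_def)
        have S0: "card S > 0" using lt by (cases "card S") auto
        let ?D = "D \<union> S"
        have cd: "card ?D = card D + card S" using fD fS disj by (rule card_Un_disjoint)
        have R': "V - ?D - \<Union>BB = R - S" by (auto simp: R_def)
        have "edge_cut E ?D (R - S) \<le> edge_cut E D (R - S) + edge_cut E S (R - S)" by (rule edge_cut_Un_left)
        also have "edge_cut E D (R - S) \<le> edge_cut E D R" by (rule edge_cut_mono) (use fD fR in auto)
        finally have "real (edge_cut E ?D (R - S)) \<le> \<kappa> * card D + \<kappa> * card S"
          using lt cD unfolding R_def by linarith
        then have ct: "edge_cut E ?D (V - ?D - \<Union>BB) \<le> \<kappa> * card ?D"
          unfolding R' cd by (simp add: algebra_simps)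
        have "card R \<le> card V" using RV finV by (rule card_mono[rotated])
        \<comment> \<open>The sizes are at most 1/8 and 1/2 of \<open>V\<close>, together 5/8: this
          is why expansion is assumed beyond one half.\<close>
        then have "4 * card ?D \<le> 3 * card V" using cd cD S(2) by linarith
        then have "8 * card ?D \<le> card V"
          using ct cD S RV UV card_U by (intro discard[of ?D "\<Union>BB"]) auto
        moreover have "B \<subseteq> V - ?D" if "B \<in> BB" for B using BV[OF that] S that by (auto simp: R_def)
        ultimately have "config ?D BB"
          using ct cD S RV unfolding config_def by (intro conjI ballI) auto
        then have "card ?D \<le> card D" by (rule maxD)
        then show False using cd S0 by simp
      qed
    qed (use fR neR \<kappa>_pos \<kappa>_le in auto)
    define U where "U = (\<lambda>B. {v \<in> R. \<exists>u\<in>B. {u, v} \<in> E})"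
    have cardU: "\<kappa> * s / \<Delta> \<le> card (U B)" if B: "B \<in> BB" for B
    proof -
      \<comment> \<open>Otherwise the whole branch set \<open>B\<close> could be moved into
        \<open>D\<close>. That gives up a branch set, which the weighting in \<open>?m\<close>
        permits.\<close>
      have "\<kappa> * card B < edge_cut E B R"
      proof (rule ccontr)
        assume "\<not> ?thesis"
        then have le: "edge_cut E B R \<le> \<kappa> * card B" by simp
        let ?D = "D \<union> B"
        have cd: "card ?D = card D + card B"
          by (rule card_Un_disjoint) (use fD fB[OF B] BV[OF B] in auto)
        have disj: "B \<inter> B' = {}" if "B' \<in> BB - {B}" for B'
        proof -
          have "pairwise (touching E) BB" using cD by blast
          then have "touching E B B'" using B that unfolding pairwise_def by blast
          then show ?thesis by (simp add: touching_def)
        qed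
        have pw: "pairwise (touching E) (BB - {B})"
          using cD pairwise_subset by blast
        have R': "V - ?D - \<Union>(BB - {B}) = R" using B by (auto simp: R_def)
        have "edge_cut E ?D R \<le> edge_cut E D R + edge_cut E B R" by (rule edge_cut_Un_left)
        then have "real (edge_cut E ?D R) \<le> \<kappa> * card D + \<kappa> * card B"
          using le cD unfolding R_def by linarith
        then have ct: "edge_cut E ?D (V - ?D - \<Union>(BB - {B})) \<le> \<kappa> * card ?D"
          unfolding R' cd by (simp add: algebra_simps)
        have "card (\<Union>(BB - {B})) \<le> card (\<Union>BB)"
          by (rule card_mono) (use fBB fB in auto)
        then have cW: "card (\<Union>(BB - {B})) \<le> h * s" using card_U by linarith
        have "4 * card ?D \<le> 3 * card V" using cd cD BV[OF B] s_le by linarith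
        then have "8 * card ?D \<le> card V"
          using ct cW cD UV BV[OF B] by (intro discard[of ?D "\<Union>(BB - {B})"]) auto
        moreover have "B' \<subseteq> V - ?D" if "B' \<in> BB - {B}" for B' using BV[of B'] disj[OF that] that by auto
        moreover have "card (BB - {B}) \<le> h" using cD fBB by (meson card_Diff1_le le_trans)
        ultimately have "config ?D (BB - {B})"
          using ct cD BV[OF B] pw unfolding config_def by (intro conjI ballI) auto
        then have "card ?D \<le> card D" by (rule maxD)
        then show False using cd s_pos BV[OF B] by simp
      qed
      also have "edge_cut E B R = edge_cut E B (U B)"
        unfolding edge_cut_def by (rule arg_cong[where f = card]) (auto simp: U_def)
      also have "\<dots> = edge_cut E (U B) B" by (rule edge_cut_commute)
      also have "real (edge_cut E (U B) B) \<le> \<Delta> * card (U B)"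
        by (rule edge_cut_le_degree[where V = V]) (use fR RV finV degree BV[OF B] in \<open>auto simp: U_def\<close>)
      finally show ?thesis using \<Delta>_pos BV[OF B] by (simp add: field_simps)
    qed
    have UR: "U B \<subseteq> R" for B by (auto simp: U_def)
    have Une: "U B \<noteq> {}" if "B \<in> BB" for B
    proof -
      have "\<kappa> * s / \<Delta> > 0" using \<kappa>_pos \<Delta>_pos s_pos by simp
      then show ?thesis using cardU[OF that] by auto
    qed
    obtain T where T: "T \<subseteq> R" "spans_connected E T" "\<forall>B\<in>BB. T \<inter> U B \<noteq> {}"
      "real (card T) \<le> 2 * k + 1 +
        (\<Sum>B\<in>BB. \<Sum>r<card R. exp (- (X.gap * card (X.nball (U B) r) * k / card R)))"
      using X.hit_all[where J = BB and U = U and k = k, OF fBB UR Une] by blast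
    define g where "g = X.gap"
    have g: "g > 0" using \<kappa>_pos \<Delta>_pos by (simp add: g_def X.gap_def)
    have geq: "\<kappa>\<^sup>2 / (16 * \<Delta>\<^sup>2) = g" by (simp add: g_def X.gap_def)
    define M where "M = card V * (1 + \<Delta> / \<kappa>) / (g * (\<kappa> * s / \<Delta>) * k) + card V * exp (- (g * k / 2))"
    have M0: "M \<ge> 0" using g \<kappa>_pos \<Delta>_pos by (simp add: M_def)
    have RVc: "real (card R) \<le> card V" using RV finV by (simp add: card_mono)
    have "(\<Sum>B\<in>BB. \<Sum>r<card R. exp (- (X.gap * card (X.nball (U B) r) * k / card R))) \<le> (\<Sum>B\<in>BB. M)"
    proof (rule sum_mono)
      fix B assume B: "B \<in> BB"
      have "(\<Sum>r<card R. exp (- (X.gap * card (X.nball (U B) r) * k / card R))) \<le>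
        card R * (1 + \<Delta> / \<kappa>) / (g * card (U B) * k) + card R * exp (- (g * k / 2))"
        unfolding g_def by (rule X.exp_ball_sum[OF UR Une[OF B] k_pos])
      also have "\<dots> \<le> M"
        unfolding M_def
      proof (intro add_mono frac_le mult_right_mono mult_left_mono)
        show "0 < g * (\<kappa> * s / \<Delta>) * k" using g \<kappa>_pos \<Delta>_pos s_pos k_pos by simp
        show "\<kappa> * s / \<Delta> \<le> card (U B)" by (rule cardU[OF B])
      qed (use RVc g \<kappa>_pos \<Delta>_pos in auto)
      finally show "(\<Sum>r<card R. exp (- (X.gap * card (X.nball (U B) r) * k / card R))) \<le> M" .
    qed
    also have "\<dots> = card BB * M" by simp
    also have "\<dots> \<le> h * M" using cD M0 by (intro mult_right_mono) auto
    finally have "real (card T) \<le> 2 * k + 1 + h * M" using T(4) by linarith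
    also have "\<dots> \<le> s" using size unfolding size_ok_def geq M_def by simp
    finally have "card T \<le> s" by simp
    \<comment> \<open>The new set is padded to exactly \<open>s\<close> vertices, so that it will in
      turn have a large neighbourhood.\<close>
    moreover have "s \<le> card R" using s_le cardR by linarith
    ultimately obtain T' where T': "T \<subseteq> T'" "T' \<subseteq> R" "spans_connected E T'" "card T' = s"
      using X.connected_extend[OF T(1,2)] by blast
    have disj: "T' \<inter> B = {}" if "B \<in> BB" for B using T'(2) that by (auto simp: R_def)
    have adj: "\<exists>x\<in>T'. \<exists>y\<in>B. {x, y} \<in> E" if "B \<in> BB" for B
    proof -
      obtain x where "x \<in> T" "x \<in> U B" using T(3) \<open>B \<in> BB\<close> by blast
      then obtain u where "u \<in> B" "{u, x} \<in> E" by (auto simp: U_def)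
      then show ?thesis using \<open>x \<in> T\<close> T'(1) by (intro bexI[of _ x] bexI[of _ u]) (auto simp: insert_commute)
    qed
    have tch: "touching E T' B" if "B \<in> BB" for B
      using adj[OF that] disj[OF that] by (simp add: touching_def)
    have "T' \<noteq> {}" using T'(4) s_pos by auto
    then have notin: "T' \<notin> BB" using disj by blast
    have "edge_cut E D (V - D - \<Union>(insert T' BB)) \<le> edge_cut E D (V - D - \<Union>BB)"
      by (rule edge_cut_mono) (use fD finV in auto)
    then have "real (edge_cut E D (V - D - \<Union>(insert T' BB))) \<le> \<kappa> * card D" using cD by linarith
    moreover have "card (insert T' BB) \<le> h" using notin fBB cD False by simp
    moreover have "T' \<subseteq> V - D" using T'(2) by (auto simp: R_def)
    moreover have "pairwise (touching E) (insert T' BB)"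
      using cD tch touching_commute by (auto simp: pairwise_insert)
    ultimately have "config D (insert T' BB)"
      using cD T' fBB unfolding config_def by (intro conjI ballI) auto
    then have "card (insert T' BB) \<le> card BB" using max[of D] by simp
    then show ?thesis using notin fBB by simp
  qed
qed

lemma clique_minor: "has_minor V E {..<h} (complete_edges h)"
proof -
  obtain BB where BB: "finite BB" "card BB = h" "\<forall>B\<in>BB. B \<subseteq> V \<and> spans_connected E B"
    "pairwise (touching E) BB"
    using branch_sets by blast
  obtain f where f: "bij_betw f {..<h} BB"
    using ex_bij_betw_nat_finite[OF BB(1)] BB(2) by (auto simp: atLeast0LessThan)
  have fin: "f i \<in> BB" if "i \<in> {..<h}" for i using f that by (auto simp: bij_betw_def)
  have inj: "f i \<noteq> f j" if "i \<in> {..<h}" "j \<in> {..<h}" "i \<noteq> j" for i j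
    using f that by (auto simp: bij_betw_def inj_on_def)
  have tch: "touching E (f i) (f j)" if "i \<in> {..<h}" "j \<in> {..<h}" "i \<noteq> j" for i j
    using BB(4) fin inj that by (simp add: pairwise_def)
  have ne: "u \<noteq> v" if "{u, v} \<in> complete_edges h" for u v
    using that by (auto simp: complete_edges_def doubleton_in_nsets_2)
  show ?thesis unfolding has_minor_def
  proof (intro exI[of _ f] conjI ballI impI)
    fix u v assume "u \<in> {..<h}" "v \<in> {..<h}" "u \<noteq> v"
    then show "f u \<inter> f v = {}" using tch by (simp add: touching_def)
  next
    fix u v assume "u \<in> {..<h}" "v \<in> {..<h}" "{u, v} \<in> complete_edges h"
    then show "\<exists>x\<in>f u. \<exists>y\<in>f v. {x, y} \<in> E" using tch ne by (simp add: touching_def)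
  qed (use BB(3) fin in auto)
qed

end

text \<open>Take \<open>s\<close> about sqrt n and \<open>k\<close> about \<open>s / 4\<close>: the
  walk uses half of \<open>s\<close>, and for small \<open>c\<close> the connecting paths use at
  most sqrt n / 8.\<close>

lemma expander_sizes:
  fixes \<kappa> \<Delta> :: real
  assumes \<kappa>: "\<kappa> > 0" "\<kappa> \<le> \<Delta>"
  shows "\<exists>c>0. \<forall>\<^sub>F n::nat in sequentially. \<forall>h::nat. real h \<le> c * sqrt n \<longrightarrow>
    (\<exists>s k. size_ok \<kappa> \<Delta> n h s k)"
proof -
  have \<Delta>: "\<Delta> > 0" using \<kappa> by simp
  define g where "g = \<kappa>\<^sup>2 / (16 * \<Delta>\<^sup>2)"
  have g: "g > 0" using \<kappa> \<Delta> by (simp add: g_def)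
  \<comment> \<open>With \<open>s\<close> \<ge> sqrt n / 2 and \<open>k\<close> \<ge> sqrt n / 16
    the expected distance to one branch set is at most \<open>32 * C\<close>, plus a term that tends
    to 0.\<close>
  define C where "C = (1 + \<Delta> / \<kappa>) / (g * (\<kappa> / \<Delta>))"
  have C: "C > 0" using \<kappa> \<Delta> g by (simp add: C_def add_pos_pos)
  \<comment> \<open>The first bound lets \<open>h\<close> sets of size \<open>s\<close> fit; the
    second keeps the total length of the connections below sqrt n / 8.\<close>
  define c where "c = min (\<kappa> / (8 * \<Delta>)) (1 / (8 * (32 * C + 1)))"
  have c: "c > 0" using \<kappa> \<Delta> C by (simp add: c_def add_pos_pos)
  have c1: "c * (8 * \<Delta>) \<le> \<kappa>"
    using \<Delta> min.cobounded1[of "\<kappa> / (8 * \<Delta>)" "1 / (8 * (32 * C + 1))"] unfolding c_def[symmetric]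
    by (simp add: pos_le_divide_eq)
  have c2: "c * (32 * C + 1) \<le> 1 / 8"
    using C min.cobounded2[of "\<kappa> / (8 * \<Delta>)" "1 / (8 * (32 * C + 1))"] unfolding c_def[symmetric]
    by (simp add: pos_le_divide_eq algebra_simps)
  have "((\<lambda>n. real n * exp (- (g * (sqrt (real n) / 16) / 2))) \<longlongrightarrow> 0) sequentially"
    using g by real_asymp
  then have ev: "\<forall>\<^sub>F n::nat in sequentially. real n * exp (- (g * (sqrt (real n) / 16) / 2)) < 1"
    by (rule order_tendstoD) simp
  have "\<forall>\<^sub>F n::nat in sequentially. \<forall>h::nat. real h \<le> c * sqrt n \<longrightarrow>
    (\<exists>s k. size_ok \<kappa> \<Delta> n h s k)"
    using ev eventually_ge_at_top[of 10000]
  proof eventually_elim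
    case (elim n)
    show ?case
    proof (intro allI impI)
      fix h :: nat assume h: "real h \<le> c * sqrt n"
      define q where "q = sqrt (real n)"
      have qq: "q * q = real n" by (simp add: q_def)
      have q: "q \<ge> 100" unfolding q_def using elim by (intro real_le_rsqrt) simp
      define s where "s = nat \<lfloor>q\<rfloor>"
      define k where "k = s div 4"
      have s1: "real s \<le> q" "real s \<ge> q - 1" using q by (auto simp: s_def)
      have k1: "4 * k \<le> s" "s < 4 * k + 4" unfolding k_def by linarith+
      have k2: "real k \<ge> q / 16" "k > 0" using s1 k1 q by linarith+
      have s2: "real s \<ge> q / 2" "s > 0" using s1 q by linarith+
      have "8 * \<Delta> * (h * s) = 8 * \<Delta> * (real h * real s)" by simp
      also have "\<dots> \<le> 8 * \<Delta> * ((c * q) * q)"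
        using h s1 c q \<Delta> unfolding q_def[symmetric] by (intro mult_left_mono mult_mono) auto
      also have "\<dots> = c * (8 * \<Delta>) * n" using qq by simp
      also have "\<dots> \<le> \<kappa> * n" using c1 by (intro mult_right_mono) auto
      finally have A: "8 * \<Delta> * (h * s) \<le> \<kappa> * n" .
      have "n * (1 + \<Delta> / \<kappa>) / (g * (\<kappa> * s / \<Delta>) * k) = n * C / (real s * real k)"
        by (simp add: C_def)
      also have "\<dots> \<le> n * C / ((q / 2) * (q / 16))"
        using s2 k2 q C by (intro divide_left_mono mult_mono mult_pos_pos) auto
      also have "\<dots> = 32 * C" using q by (simp flip: qq)
      finally have 1: "n * (1 + \<Delta> / \<kappa>) / (g * (\<kappa> * s / \<Delta>) * k) \<le> 32 * C" .
      have "real n * exp (- (g * k / 2)) \<le> real n * exp (- (g * (q / 16) / 2))"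
        using k2 g by (intro mult_left_mono) auto
      also have "\<dots> \<le> 1" using elim(1) by (simp add: q_def)
      finally have 2: "n * exp (- (g * k / 2)) \<le> 1" .
      have "h * (n * (1 + \<Delta> / \<kappa>) / (g * (\<kappa> * s / \<Delta>) * k) + n * exp (- (g * k / 2))) \<le>
          (c * q) * (32 * C + 1)"
        using h 1 2 C c q \<kappa> \<Delta> g unfolding q_def[symmetric]
        by (intro mult_mono add_mono add_nonneg_nonneg divide_nonneg_nonneg mult_nonneg_nonneg) auto
      also have "\<dots> = c * (32 * C + 1) * q" by simp
      also have "\<dots> \<le> 1 / 8 * q" using c2 q by (intro mult_right_mono) auto
      finally have "2 * k + 1 + h * (n * (1 + \<Delta> / \<kappa>) / (g * (\<kappa> * s / \<Delta>) * k) + n * exp (- (g * k / 2))) \<le> s"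
        using k1 s1 q by linarith
      then have "size_ok \<kappa> \<Delta> n h s k"
        unfolding size_ok_def g_def[symmetric] using A k2 s2 by simp
      then show "\<exists>s k. size_ok \<kappa> \<Delta> n h s k" by blast
    qed
  qed
  then show ?thesis using c by blast
qed

lemma expander_minor:
  fixes \<kappa> \<Delta> :: real
  assumes \<kappa>: "\<kappa> > 0" "\<kappa> \<le> \<Delta>"
  shows "\<exists>c>0. \<exists>n0. \<forall>V (E :: 'a set set) h. finite V \<longrightarrow> n0 \<le> card V \<longrightarrow>
    (\<forall>v\<in>V. real (card {u \<in> V. {u, v} \<in> E}) \<le> \<Delta>) \<longrightarrow>
    (\<forall>S\<subseteq>V. 4 * card S \<le> 3 * card V \<longrightarrow> 2 * \<kappa> * card S \<le> edge_cut E S (V - S)) \<longrightarrow>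
    real h \<le> c * sqrt (card V) \<longrightarrow> has_minor V E {..<h} (complete_edges h)"
proof -
  obtain c where c: "c > 0" and
      "\<forall>\<^sub>F n in sequentially. \<forall>h::nat. real h \<le> c * sqrt n \<longrightarrow> (\<exists>s k. size_ok \<kappa> \<Delta> n h s k)"
    using expander_sizes[OF assms] by blast
  then obtain n0 where n0: "\<And>n h::nat. n0 \<le> n \<Longrightarrow> real h \<le> c * sqrt n \<Longrightarrow> \<exists>s k. size_ok \<kappa> \<Delta> n h s k"
    unfolding eventually_sequentially by blast
  have main: "has_minor V E {..<h} (complete_edges h)"
    \<comment> \<open>The successor guarantees that \<open>V\<close> is nonempty.\<close>
    if V: "finite V" "Suc n0 \<le> card V" "\<forall>v\<in>V. real (card {u \<in> V. {u, v} \<in> E}) \<le> \<Delta>"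
      "\<forall>S\<subseteq>V. 4 * card S \<le> 3 * card V \<longrightarrow> 2 * \<kappa> * card S \<le> edge_cut E S (V - S)"
      "real h \<le> c * sqrt (card V)"
    for V and E :: "'a set set" and h
  proof (cases "h = 0")
    case True
    then show ?thesis by (simp add: has_minor_def)
  next
    case False
    obtain s k where sk: "size_ok \<kappa> \<Delta> (card V) h s k"
      using n0[OF Suc_leD[OF V(2)] V(5)] by blast
    interpret strong_expander E V \<kappa> \<Delta> s h k
    proof
      show "V \<noteq> {}" using V(2) by auto
      show "real (card {u \<in> V. {u, v} \<in> E}) \<le> \<Delta>" if "v \<in> V" for v using V(3) that by blast
      show "2 * \<kappa> * card S \<le> edge_cut E S (V - S)" if "S \<subseteq> V" "4 * card S \<le> 3 * card V" for S
        using V(4) that by blast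
      show "h > 0" using False by simp
    qed (fact V(1) \<kappa> sk)+
    show ?thesis by (rule clique_minor)
  qed
  show ?thesis
    by (intro exI[of _ c] conjI c exI[of _ "Suc n0"] allI impI) (rule main)
qed

section \<open>A derandomised strategy for Client\<close>

text \<open>The conditional probability that \<open>F\<close> survives when \<open>K\<close> is kept out of the elements \<open>O\<close>
  offered so far and every other element is kept independently with probability \<open>p\<close>.\<close>

definition survival :: "real \<Rightarrow> 'e set \<Rightarrow> 'e set \<Rightarrow> 'e set \<Rightarrow> real" where
  "survival p K Y F = (if F \<inter> Y \<subseteq> K then p ^ card (F - Y) else 0)"

text \<open>At most one element of \<open>Q\<close> is kept. If \<open>F\<close> meets
  \<open>Q\<close> in no or one element, the average equals what independent choices give; if in two
  or more, \<open>F\<close> cannot survive. Excluding joint choices thus only helps.\<close>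

lemma survival_average:
  fixes p :: real
  assumes Q: "finite Q" "Q \<inter> Y = {}" and K: "K \<subseteq> Y" and F: "finite F"
    and p: "p \<ge> 0" "p * card Q \<le> 1"
  shows "p * (\<Sum>e\<in>Q. survival p (insert e K) (Y \<union> Q) F) + (1 - p * card Q) * survival p K (Y \<union> Q) F
    \<le> survival p K Y F"
proof (cases "F \<inter> Y \<subseteq> K")
  case False
  then have "survival p (insert e K) (Y \<union> Q) F = 0" if "e \<in> Q" for e
    using that Q(2) by (auto simp: survival_def)
  moreover have "survival p K (Y \<union> Q) F = 0" using False by (auto simp: survival_def)
  ultimately show ?thesis using False by (simp add: survival_def)
next
  case True
  consider "F \<inter> Q = {}" | a where "F \<inter> Q = {a}" | a a' where "a \<in> F \<inter> Q" "a' \<in> F \<inter> Q" "a \<noteq> a'"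
    by blast
  then show ?thesis
  proof cases
    case 1
    have "F - (Y \<union> Q) = F - Y" using 1 by auto
    then have "survival p (insert e K) (Y \<union> Q) F = survival p K Y F" if "e \<in> Q" for e
      using True 1 by (auto simp: survival_def)
    moreover have "survival p K (Y \<union> Q) F = survival p K Y F"
      using True 1 \<open>F - (Y \<union> Q) = F - Y\<close> by (auto simp: survival_def)
    ultimately show ?thesis by (simp add: algebra_simps)
  next
    case (2 a)
    have a: "a \<in> Q" "a \<in> F" "a \<notin> Y" using 2 Q(2) by auto
    have "survival p K (Y \<union> Q) F = 0" using a K by (auto simp: survival_def)
    moreover have "survival p (insert e K) (Y \<union> Q) F = (if e = a then p ^ card (F - (Y \<union> Q)) else 0)"
      if "e \<in> Q" for e
      using that a K True 2 by (auto simp: survival_def)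
    moreover have "F - Y = insert a (F - (Y \<union> Q))" using 2 a by auto
    then have "card (F - Y) = Suc (card (F - (Y \<union> Q)))" using F a by simp
    ultimately show ?thesis using Q(1) a True by (simp add: survival_def)
  next
    case (3 a a')
    have "a \<notin> K" "a' \<notin> K" using 3 Q(2) K by auto
    then have "survival p (insert e K) (Y \<union> Q) F = 0" for e
      using 3 by (auto simp: survival_def)
    moreover have "survival p K (Y \<union> Q) F = 0" using 3 \<open>a \<notin> K\<close> by (auto simp: survival_def)
    ultimately show ?thesis using p by (simp add: survival_def)
  qed
qed

text \<open>The conditional expectation of the number of members of \<open>FF\<close> that survive
  minus the final number of kept elements; \<open>p * card (X - Y)\<close> is the number of elements
  still expected.\<close>

definition potential :: "real \<Rightarrow> 'e set \<Rightarrow> 'e set set \<Rightarrow> 'e set \<Rightarrow> 'e set \<Rightarrow> real" where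
  "potential p X FF K Y = (\<Sum>F\<in>FF. survival p K Y F) - card K - p * card (X - Y)"

lemma potential_average:
  fixes p :: real
  assumes X: "finite X" "Q \<subseteq> X - Y" "Y \<subseteq> X" and K: "K \<subseteq> Y" and FF: "\<And>F. F \<in> FF \<Longrightarrow> finite F"
    and p: "p \<ge> 0" "p * card Q \<le> 1"
  shows "p * (\<Sum>e\<in>Q. potential p X FF (insert e K) (Y \<union> Q)) + (1 - p * card Q) * potential p X FF K (Y \<union> Q)
    \<le> potential p X FF K Y"
proof -
  have dQ: "Q \<inter> Y = {}" and fQ: "finite Q" and fK: "finite K"
    using X K by (auto intro: finite_subset[OF _ X(1)])
  let ?q = "p * card (X - (Y \<union> Q))"
  have cX: "card (X - Y) = card (X - (Y \<union> Q)) + card Q"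
  proof -
    have "X - Y = (X - (Y \<union> Q)) \<union> Q" using X by auto
    moreover have "card ((X - (Y \<union> Q)) \<union> Q) = card (X - (Y \<union> Q)) + card Q"
      by (rule card_Un_disjoint) (use X fQ in auto)
    ultimately show ?thesis by simp
  qed
  have "card (insert e K) = card K + 1" if "e \<in> Q" for e
    using that fK K dQ by (subst card_insert_disjoint) auto
  then have "(\<Sum>e\<in>Q. potential p X FF (insert e K) (Y \<union> Q)) =
      (\<Sum>e\<in>Q. (\<Sum>F\<in>FF. survival p (insert e K) (Y \<union> Q) F) - (card K + 1) - ?q)"
    by (intro sum.cong) (auto simp: potential_def)
  also have "\<dots> = (\<Sum>F\<in>FF. \<Sum>e\<in>Q. survival p (insert e K) (Y \<union> Q) F) - card Q * (card K + 1 + ?q)"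
    by (simp add: sum_subtractf sum.swap[of _ Q] algebra_simps)
  finally have 1: "(\<Sum>e\<in>Q. potential p X FF (insert e K) (Y \<union> Q)) =
    (\<Sum>F\<in>FF. \<Sum>e\<in>Q. survival p (insert e K) (Y \<union> Q) F) - card Q * (card K + 1 + ?q)" .
  have "(\<Sum>F\<in>FF. p * (\<Sum>e\<in>Q. survival p (insert e K) (Y \<union> Q) F) + (1 - p * card Q) * survival p K (Y \<union> Q) F)
      \<le> (\<Sum>F\<in>FF. survival p K Y F)"
    by (intro sum_mono survival_average) (use fQ dQ K FF p in auto)
  then have "p * (\<Sum>F\<in>FF. \<Sum>e\<in>Q. survival p (insert e K) (Y \<union> Q) F) +
      (1 - p * card Q) * (\<Sum>F\<in>FF. survival p K (Y \<union> Q) F) \<le> (\<Sum>F\<in>FF. survival p K Y F)"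
    by (simp add: sum.distrib sum_distrib_left)
  then show ?thesis unfolding 1 unfolding potential_def cX by (simp add: algebra_simps)
qed

text \<open>A weighted average of the options does not exceed the old value, so some option does not
  either. Client must claim an element even when the best option keeps nothing, hence
  \<open>K'\<close> is only required to lie in \<open>insert e K\<close>.\<close>

lemma potential_step:
  fixes p :: real
  assumes X: "finite X" "Q \<subseteq> X - Y" "Y \<subseteq> X" "Q \<noteq> {}" and K: "K \<subseteq> Y" and FF: "\<And>F. F \<in> FF \<Longrightarrow> finite F"
    and p: "p \<ge> 0" "p * card Q \<le> 1"
  shows "\<exists>e\<in>Q. \<exists>K'. K' \<subseteq> insert e K \<and> K' \<subseteq> Y \<union> Q \<and> potential p X FF K' (Y \<union> Q) \<le> potential p X FF K Y"
proof (rule ccontr)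
  assume neg: "\<not> ?thesis"
  let ?c = "potential p X FF K Y"
  have fQ: "finite Q" using X(2) by (auto intro: finite_subset[OF _ X(1)])
  have 1: "?c < potential p X FF (insert e K) (Y \<union> Q)" if "e \<in> Q" for e
    using neg that K by (meson insert_subset not_le order_refl subset_trans sup_ge1 sup_ge2 subsetD)
  have 2: "?c < potential p X FF K (Y \<union> Q)"
    using neg X(4) K by (meson ex_in_conv not_le subset_insertI subset_trans sup_ge1)
  have cQ: "card Q > 0" using fQ X(4) by (simp add: card_gt_0_iff)
  have "?c < p * (\<Sum>e\<in>Q. potential p X FF (insert e K) (Y \<union> Q)) + (1 - p * card Q) * potential p X FF K (Y \<union> Q)"
  \<comment> \<open>The weight \<open>1 - p * card Q\<close> of keeping nothing may be 0, so for
    positive \<open>p\<close> strictness has to come from the sum; for \<open>p = 0\<close> all the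
    weight is on keeping nothing.\<close>
  proof (cases "p = 0")
    case True then show ?thesis using 2 by simp
  next
    case False
    then have "p > 0" using p by simp
    have "card Q * ?c = (\<Sum>e\<in>Q. ?c)" by simp
    also have "\<dots> < (\<Sum>e\<in>Q. potential p X FF (insert e K) (Y \<union> Q))"
      by (rule sum_strict_mono[OF fQ X(4) 1])
    finally have "p * (card Q * ?c) < p * (\<Sum>e\<in>Q. potential p X FF (insert e K) (Y \<union> Q))"
      using \<open>p > 0\<close> by simp
    moreover have "(1 - p * card Q) * ?c \<le> (1 - p * card Q) * potential p X FF K (Y \<union> Q)"
      using p 2 by (intro mult_left_mono) auto
    ultimately show ?thesis by (simp add: algebra_simps)
  qed
  with potential_average[where FF = FF, OF X(1-3) K FF p] show False by simp
qed

lemma client_keeps_potential: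
  fixes p :: real
  assumes X: "finite X" and FF: "\<And>F. F \<in> FF \<Longrightarrow> finite F"
    and p: "p \<ge> 0" "p * (real b + 1) \<le> 1"
  shows "client_can_achieve b X (\<lambda>C. \<exists>K\<subseteq>C. K \<subseteq> X \<and> potential p X FF K X \<le> potential p X FF {} {})"
proof -
  let ?c = "potential p X FF {} {}"
  define ok where "ok = (\<lambda>C Y. \<exists>K\<subseteq>C. K \<subseteq> Y \<and> potential p X FF K Y \<le> ?c)"
  define good where "good = (\<lambda>h Q e. ok (insert e (client_claimed h)) (offered h \<union> Q))"
  \<comment> \<open>The kept set \<open>K\<close> is not part of the strategy: the invariant only
    says that one exists. Where no good element exists, any element of \<open>Q\<close> is chosen,
    which makes the strategy legal on unreachable histories too.\<close>
  define \<sigma> where "\<sigma> = (\<lambda>h Q. SOME e. e \<in> Q \<and> ((\<exists>e\<in>Q. good h Q e) \<longrightarrow> good h Q e))"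
  have \<sigma>: "\<sigma> h Q \<in> Q \<and> ((\<exists>e\<in>Q. good h Q e) \<longrightarrow> good h Q (\<sigma> h Q))" if "Q \<noteq> {}" for h Q
    unfolding \<sigma>_def by (rule someI_ex) (use that in blast)
  have inv: "offered h \<subseteq> X \<and> ok (client_claimed h) (offered h)" if "cw_play b X \<sigma> h" for h
    using that
  proof (induction rule: cw_play.induct)
    case start
    then show ?case by (auto simp: offered_def client_claimed_def ok_def)
  next
    case (offer h Q)
    have Q0: "Q \<noteq> {}" using offer(3) by auto
    obtain K where K: "K \<subseteq> client_claimed h" "K \<subseteq> offered h" "potential p X FF K (offered h) \<le> ?c"
      using offer(5) unfolding ok_def by blast
    have "p * real (card Q) \<le> p * (real b + 1)"
      using offer(4) p by (intro mult_left_mono) auto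
    then have pQ: "p * card Q \<le> 1" using p by linarith
    obtain e K' where e: "e \<in> Q" "K' \<subseteq> insert e K" "K' \<subseteq> offered h \<union> Q"
      "potential p X FF K' (offered h \<union> Q) \<le> potential p X FF K (offered h)"
      using potential_step[OF X offer(2) _ Q0 K(2) FF p(1) pQ] offer(5) by blast
    have "good h Q e"
      unfolding good_def ok_def
    proof (intro exI[of _ K'] conjI)
      show "K' \<subseteq> insert e (client_claimed h)" using e(2) K(1) by blast
      show "potential p X FF K' (offered h \<union> Q) \<le> ?c" using e(4) K(3) by linarith
    qed (rule e(3))
    then have "good h Q (\<sigma> h Q)" using \<sigma>[OF Q0] e(1) by blast
    moreover have "offered (h @ [(Q, \<sigma> h Q)]) = offered h \<union> Q"
      by (auto simp: offered_def)
    moreover have "client_claimed (h @ [(Q, \<sigma> h Q)]) = insert (\<sigma> h Q) (client_claimed h)"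
      by (auto simp: client_claimed_def)
    moreover have "offered h \<union> Q \<subseteq> X" using offer(2,5) by blast
    ultimately show ?case unfolding good_def by simp
  qed
  show ?thesis unfolding client_can_achieve_def
  proof (intro exI[of _ \<sigma>] conjI allI impI)
    show "legal_strategy \<sigma>" unfolding legal_strategy_def using \<sigma> by blast
    fix h assume "cw_play b X \<sigma> h \<and> offered h = X"
    then show "\<exists>K\<subseteq>client_claimed h. K \<subseteq> X \<and> potential p X FF K X \<le> ?c"
      using inv[of h] unfolding ok_def by auto
  qed
qed

lemma client_can_achieve_mono:
  assumes "client_can_achieve b X P" "\<And>C. P C \<Longrightarrow> P' C"
  shows "client_can_achieve b X P'"
  using assms unfolding client_can_achieve_def by blast

text \<open>Removing an element from each member of \<open>FF\<close> contained in the kept set costs no more than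
  the expected number of such members for a random set.\<close>

lemma client_avoids:
  fixes p :: real
  assumes X: "finite X" and FF: "finite FF" "\<And>F. F \<in> FF \<Longrightarrow> F \<subseteq> X" "{} \<notin> FF"
    and p: "p \<ge> 0" "p * (real b + 1) \<le> 1"
  shows "client_can_achieve b X (\<lambda>C. \<exists>K\<subseteq>C. K \<subseteq> X \<and> (\<forall>F\<in>FF. \<not> F \<subseteq> K) \<and>
    p * card X \<le> card K + (\<Sum>F\<in>FF. p ^ card F))"
proof (rule client_can_achieve_mono)
  have fin: "\<And>F. F \<in> FF \<Longrightarrow> finite F" using FF(2) X finite_subset by blast
  show "client_can_achieve b X (\<lambda>C. \<exists>K\<subseteq>C. K \<subseteq> X \<and> potential p X FF K X \<le> potential p X FF {} {})"
    by (rule client_keeps_potential[OF X fin p])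
  fix C assume "\<exists>K\<subseteq>C. K \<subseteq> X \<and> potential p X FF K X \<le> potential p X FF {} {}"
  then obtain K where K: "K \<subseteq> C" "K \<subseteq> X" "potential p X FF K X \<le> potential p X FF {} {}" by blast
  have fK: "finite K" using K X finite_subset by blast
  define B where "B = {F \<in> FF. F \<subseteq> K}"
  have "survival p K X F = (if F \<subseteq> K then 1 else 0)" if "F \<in> FF" for F
    using FF(2)[OF that] by (simp add: survival_def Int_absorb2 Diff_eq_empty_iff[THEN iffD2])
  then have "(\<Sum>F\<in>FF. survival p K X F) = card B"
    using FF(1) by (simp add: B_def sum.If_cases Int_def)
  then have c: "card B + p * card X \<le> card K + (\<Sum>F\<in>FF. p ^ card F)"
    using K(3) by (simp add: potential_def survival_def)
  define f where "f = (\<lambda>F::'a set. SOME x. x \<in> F)"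
  have f: "f F \<in> F" if "F \<in> FF" for F
    using FF(3) that unfolding f_def by (metis ex_in_conv someI_ex)
  have fB: "finite B" using FF(1) by (simp add: B_def)
  let ?K = "K - f ` B"
  have "card K \<le> card ?K + card (f ` B)"
    using fB by (metis add.commute card_le_sym_Diff diff_card_le_card_Diff finite_imageI le_diff_conv)
  moreover have "card (f ` B) \<le> card B" by (rule card_image_le[OF fB])
  ultimately have "p * card X \<le> card ?K + (\<Sum>F\<in>FF. p ^ card F)" using c by linarith
  moreover have "\<not> F \<subseteq> ?K" if "F \<in> FF" for F
    using f[OF that] that by (auto simp: B_def)
  ultimately show "\<exists>K\<subseteq>C. K \<subseteq> X \<and> (\<forall>F\<in>FF. \<not> F \<subseteq> K) \<and> p * card X \<le> card K + (\<Sum>F\<in>FF. p ^ card F)"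
    using K by (intro exI[of _ ?K]) auto
qed

section \<open>Sparse random-like graphs\<close>

text \<open>\<open>k ^ k / fact k\<close> is a single term of the exponential series at
  \<open>k\<close>.\<close>

lemma binomial_le_exp_power:
  assumes "k \<ge> 1"
  shows "real (n choose k) \<le> (exp 1 * n / k) ^ k"
proof -
  have "real k ^ k / fact k \<le> exp (real k)"
  proof -
    have "(\<Sum>i\<in>{k}. inverse (fact i) * real k ^ i) \<le> (\<Sum>i. inverse (fact i) * real k ^ i)"
      by (intro sum_le_suminf summable_exp) auto
    also have "\<dots> = exp (real k)" by (simp add: exp_def)
    finally show ?thesis by (simp add: field_simps)
  qed
  also have "exp (real k) = exp 1 ^ k" by (simp flip: exp_of_nat_mult)
  finally have f: "real k ^ k \<le> exp 1 ^ k * fact k" by (simp add: pos_divide_le_eq)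
  have "real ((n choose k) * fact k) \<le> real (n ^ k)"
    using binomial_fact_pow[of n k] by (simp only: of_nat_le_iff)
  then have b: "real (n choose k) * fact k \<le> real n ^ k" by simp
  have "real (n choose k) * real k ^ k \<le> real (n choose k) * (exp 1 ^ k * fact k)"
    using f by (rule mult_left_mono) simp
  also have "\<dots> \<le> exp 1 ^ k * real n ^ k"
    using b by (simp add: mult_left_mono mult.left_commute)
  finally show ?thesis using assms by (simp add: power_divide power_mult_distrib pos_le_divide_eq)
qed

text \<open>A first-moment bound with x = 3 * e * k / (2 * n). The edge part is at most x ^ m. Here
  k of the factors combine with (e * n / k) ^ k to (3 * e^2 / 2) ^ k, and the remaining factors, at
  least \<delta> * k of them, contribute at most (1 / (3 * e^2)) ^ k.\<close>

lemma dense_term_bound: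
  fixes p \<delta> z :: real
  assumes k: "k \<ge> 1" and n: "n \<ge> 1" and z: "z > 0" "z \<le> 1" "3 * exp 1 * real k / (2 * real n) \<le> z"
    and z\<delta>: "z powr \<delta> \<le> 1 / (3 * (exp 1)\<^sup>2)" and \<delta>: "\<delta> > 0"
    and m: "(1 + \<delta>) * k \<le> real m" and p: "0 \<le> p" "p \<le> 3 / n"
  shows "real (n choose k) * (real ((k choose 2) choose m) * p ^ m) \<le> (1 / 2) ^ k"
proof -
  define e where "e = exp (1 :: real)"
  have e: "e > 0" by (simp add: e_def)
  define x where "x = 3 * e * k / (2 * real n)"
  have x: "x > 0" "x \<le> z" using k n e z by (auto simp: x_def e_def)
  have "real k \<le> (1 + \<delta>) * k" using \<delta> by (simp add: algebra_simps)
  then have mk: "real k \<le> m" using m by linarith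
  then have m1: "m \<ge> 1" using k by linarith
  have "real (k choose 2) \<le> real k * real k / 2"
  proof -
    have "2 * (k choose 2) \<le> k * k" by (simp add: choose_two algebra_simps)
    then have "real (2 * (k choose 2)) \<le> real (k * k)" by (simp only: of_nat_le_iff)
    then show ?thesis by simp
  qed
  also have "\<dots> \<le> real k * real m / 2" using mk by (intro divide_right_mono mult_left_mono) auto
  finally have "e * real (k choose 2) \<le> e * (real k * real m / 2)"
    using e by (intro mult_left_mono) auto
  also have "\<dots> = (e * k / 2) * m" by simp
  finally have k2: "e * real (k choose 2) / m \<le> e * k / 2"
    using m1 by (subst pos_divide_le_eq) simp_all
  have "real ((k choose 2) choose m) * p ^ m \<le> (e * k / 2) ^ m * (3 / n) ^ m"
  proof (intro mult_mono power_mono)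
    have "real ((k choose 2) choose m) \<le> (e * real (k choose 2) / m) ^ m"
      unfolding e_def by (rule binomial_le_exp_power[OF m1])
    also have "\<dots> \<le> (e * k / 2) ^ m" using k2 e by (intro power_mono) auto
    finally show "real ((k choose 2) choose m) \<le> (e * k / 2) ^ m" .
  qed (use p e in auto)
  also have "\<dots> = (e * k / 2 * (3 / n)) ^ m" by (simp only: power_mult_distrib)
  also have "e * k / 2 * (3 / n) = x" by (simp add: x_def)
  also have "x ^ m = x ^ k * x ^ (m - k)" using mk by (simp add: power_add[symmetric])
  also have "\<dots> \<le> x ^ k * (1 / (3 * e\<^sup>2)) ^ k"
  proof (rule mult_left_mono)
    have "x ^ (m - k) = x powr (m - k)" using x by (simp add: powr_realpow)
    also have "\<dots> \<le> z powr (m - k)" using x by (intro powr_mono2) auto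
    also have "\<dots> \<le> z powr (\<delta> * k)"
      using z m mk by (intro powr_mono') (auto simp: of_nat_diff algebra_simps)
    also have "\<dots> = (z powr \<delta>) ^ k" using z(1) powr_realpow[of "z powr \<delta>" k] by (simp add: powr_powr)
    also have "\<dots> \<le> (1 / (3 * e\<^sup>2)) ^ k" using z\<delta> by (intro power_mono) (auto simp: e_def)
    finally show "x ^ (m - k) \<le> (1 / (3 * e\<^sup>2)) ^ k" .
  qed (use x in simp)
  finally have 1: "real ((k choose 2) choose m) * p ^ m \<le> (x * (1 / (3 * e\<^sup>2))) ^ k"
    by (simp only: power_mult_distrib)
  have "real (n choose k) * (real ((k choose 2) choose m) * p ^ m) \<le>
      (e * n / k) ^ k * (x * (1 / (3 * e\<^sup>2))) ^ k"
    using 1 binomial_le_exp_power[OF k, of n] p e x unfolding e_def[symmetric]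
    by (intro mult_mono) auto
  also have "\<dots> = (1 / 2) ^ k"
    unfolding power_mult_distrib[symmetric] using k n e by (simp add: x_def power2_eq_square field_simps)
  finally show ?thesis .
qed

lemma sum_UN_le:
  fixes f :: "'b \<Rightarrow> real"
  assumes "finite I" "\<And>i. i \<in> I \<Longrightarrow> finite (A i)" "\<And>x. f x \<ge> 0"
  shows "sum f (\<Union>i\<in>I. A i) \<le> (\<Sum>i\<in>I. sum f (A i))"
  using assms(1,2)
proof (induction I rule: finite_induct)
  case (insert i I)
  have "sum f (A i \<union> (\<Union>i\<in>I. A i)) \<le> sum f (A i) + sum f (\<Union>i\<in>I. A i)"
    using insert by (subst sum_Un) (auto intro!: sum_nonneg assms(3))
  then show ?case using insert by simp
qed simp

lemma card_nsets:
  assumes "finite A"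
  shows "card (nsets A k) = card A choose k"
proof -
  have "nsets A k = {N. N \<subseteq> A \<and> card N = k}"
    using finite_subset[OF _ assms] by (auto simp: nsets_def)
  then show ?thesis using n_subsets[OF assms] by simp
qed

section \<open>First-moment bounds for large stars and small dense sets\<close>

definition star :: "nat \<Rightarrow> nat \<Rightarrow> nat set set" where
  "star n v = {e \<in> complete_edges n. v \<in> e}"

definition stars :: "nat \<Rightarrow> nat \<Rightarrow> nat set set set" where
  "stars n d = (\<Union>v<n. nsets (star n v) d)"

text \<open>Only edge sets of exactly the threshold size are listed; a denser vertex set contains
  one of them.\<close>

definition dense_sets :: "real \<Rightarrow> real \<Rightarrow> nat \<Rightarrow> nat set set set" where
  "dense_sets \<delta> \<beta> n = (\<Union>k\<in>{k. 1 \<le> k \<and> k \<le> \<beta> * n}. \<Union>W\<in>nsets {..<n} k. nsets (nsets W 2) (nat \<lceil>(1 + \<delta>) * k\<rceil>))"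

lemma finite_complete_edges [simp]: "finite (complete_edges n)"
  by (simp add: complete_edges_def finite_imp_finite_nsets)

lemma finite_star [simp]: "finite (star n v)"
  by (simp add: star_def)

lemma card_star_le: "card (star n v) \<le> n"
proof -
  have "star n v \<subseteq> (\<lambda>u. {u, v}) ` {..<n}"
  proof
    fix e assume "e \<in> star n v"
    then obtain x y where "e = {x, y}" "x < n" "y < n" "v = x \<or> v = y"
      by (auto simp: star_def complete_edges_def elim!: nsets2_E)
    then show "e \<in> (\<lambda>u. {u, v}) ` {..<n}" by (auto simp: insert_commute)
  qed
  then have "card (star n v) \<le> card ((\<lambda>u. {u, v}) ` {..<n})" by (intro card_mono) auto
  also have "\<dots> \<le> card {..<n}" by (rule card_image_le) simp
  finally show ?thesis by simp
qed

lemma stars_sum: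
  fixes p :: real
  assumes p: "0 \<le> p" "p \<le> 3 / n" and n: "n \<ge> 1"
  shows "(\<Sum>F\<in>stars n d. p ^ card F) \<le> n * (3 ^ d / fact d)"
proof -
  have "(\<Sum>F\<in>stars n d. p ^ card F) \<le> (\<Sum>v<n. \<Sum>F\<in>nsets (star n v) d. p ^ card F)"
    unfolding stars_def by (rule sum_UN_le) (use p in \<open>auto simp: finite_imp_finite_nsets\<close>)
  also have "\<dots> \<le> (\<Sum>v<n. 3 ^ d / fact d)"
  proof (rule sum_mono)
    fix v
    have "(\<Sum>F\<in>nsets (star n v) d. p ^ card F) = (\<Sum>F\<in>nsets (star n v) d. p ^ d)"
      by (intro sum.cong) (auto simp: nsets_def)
    also have "\<dots> = real (card (star n v) choose d) * p ^ d" by (simp add: card_nsets)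
    also have "\<dots> \<le> (real n ^ d / fact d) * (3 / n) ^ d"
    proof (intro mult_mono power_mono)
      have "(card (star n v) choose d) * fact d \<le> n ^ d"
        using binomial_fact_pow[of "card (star n v)" d] power_mono[OF card_star_le[of n v], of d] by linarith
      then have "real ((card (star n v) choose d) * fact d) \<le> real (n ^ d)" by (simp only: of_nat_le_iff)
      then show "real (card (star n v) choose d) \<le> real n ^ d / fact d" by (simp add: pos_le_divide_eq)
    qed (use p in auto)
    also have "\<dots> = 3 ^ d / fact d" using n by (simp add: power_divide)
    finally show "(\<Sum>F\<in>nsets (star n v) d. p ^ card F) \<le> 3 ^ d / fact d" .
  qed
  finally show ?thesis by simp
qed

lemma dense_sets_sum:
  fixes p \<delta> \<beta> z :: real
  assumes n: "n \<ge> 1" and z: "z > 0" "z \<le> 1" "3 * exp 1 * \<beta> / 2 \<le> z" and \<beta>: "\<beta> > 0"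
    and z\<delta>: "z powr \<delta> \<le> 1 / (3 * (exp 1)\<^sup>2)" and \<delta>: "\<delta> > 0" and p: "0 \<le> p" "p \<le> 3 / n"
  shows "(\<Sum>F\<in>dense_sets \<delta> \<beta> n. p ^ card F) \<le> 1"
proof -
  let ?I = "{k. 1 \<le> k \<and> real k \<le> \<beta> * n}"
  let ?m = "\<lambda>k. nat \<lceil>(1 + \<delta>) * real k\<rceil>"
  have sub: "?I \<subseteq> {1..nat \<lfloor>\<beta> * n\<rfloor>}" by (auto simp: le_nat_floor)
  have fI: "finite ?I" by (rule finite_subset[OF sub]) simp
  have "(\<Sum>F\<in>dense_sets \<delta> \<beta> n. p ^ card F) \<le> (\<Sum>k\<in>?I. \<Sum>F\<in>(\<Union>W\<in>nsets {..<n} k. nsets (nsets W 2) (?m k)). p ^ card F)"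
    unfolding dense_sets_def
    by (rule sum_UN_le[OF fI]) (use p in \<open>auto simp: finite_imp_finite_nsets nsets_def\<close>)
  also have "\<dots> \<le> (\<Sum>k\<in>?I. (1 / 2) ^ k)"
  proof (rule sum_mono)
    fix k assume k: "k \<in> ?I"
    have "(\<Sum>F\<in>(\<Union>W\<in>nsets {..<n} k. nsets (nsets W 2) (?m k)). p ^ card F) \<le>
        (\<Sum>W\<in>nsets {..<n} k. \<Sum>F\<in>nsets (nsets W 2) (?m k). p ^ card F)"
      by (rule sum_UN_le) (use p in \<open>auto simp: finite_imp_finite_nsets nsets_def\<close>)
    also have "\<dots> = (\<Sum>W\<in>nsets {..<n} k. real ((k choose 2) choose ?m k) * p ^ ?m k)"
    proof (rule sum.cong[OF refl])
      fix W assume W: "W \<in> nsets {..<n} k"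
      have "(\<Sum>F\<in>nsets (nsets W 2) (?m k). p ^ card F) = (\<Sum>F\<in>nsets (nsets W 2) (?m k). p ^ ?m k)"
        by (intro sum.cong) (auto simp: nsets_def)
      then show "(\<Sum>F\<in>nsets (nsets W 2) (?m k). p ^ card F) = real ((k choose 2) choose ?m k) * p ^ ?m k"
        using W by (simp add: card_nsets finite_imp_finite_nsets) (auto simp: nsets_def card_nsets)
    qed
    also have "\<dots> = real (n choose k) * (real ((k choose 2) choose ?m k) * p ^ ?m k)"
      by (simp add: card_nsets)
    also have "\<dots> \<le> (1 / 2) ^ k"
    proof (rule dense_term_bound[OF _ n z(1,2) _ z\<delta> \<delta> _ p])
      show "1 \<le> k" using k by simp
      have "3 * exp 1 * real k / (2 * real n) \<le> 3 * exp 1 * (\<beta> * n) / (2 * real n)"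
        using k n by (intro divide_right_mono mult_left_mono) auto
      also have "\<dots> = 3 * exp 1 * \<beta> / 2" using n by simp
      finally show "3 * exp 1 * real k / (2 * real n) \<le> z" using z by linarith
      show "(1 + \<delta>) * real k \<le> real (?m k)" by linarith
    qed
    finally show "(\<Sum>F\<in>(\<Union>W\<in>nsets {..<n} k. nsets (nsets W 2) (?m k)). p ^ card F) \<le> (1 / 2) ^ k" .
  qed
  also have "\<dots> \<le> (\<Sum>k=1..nat \<lfloor>\<beta> * n\<rfloor>. (1 / 2) ^ k)"
    by (rule sum_mono2) (use sub in auto)
  also have "\<dots> = (\<Sum>k<nat \<lfloor>\<beta> * n\<rfloor>. (1 / 2) ^ Suc k)"
    by (rule sum.reindex_bij_witness[of _ Suc "\<lambda>k. k - 1"]) auto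
  also have "\<dots> \<le> (\<Sum>k. (1 / 2) ^ Suc k)"
    by (rule sum_le_suminf) (use power_half_series in \<open>auto simp: sums_iff\<close>)
  also have "\<dots> = 1" using power_half_series by (simp add: sums_iff)
  finally show ?thesis .
qed

lemma dense_threshold:
  fixes \<delta> :: real
  assumes "\<delta> > 0"
  obtains \<beta> z :: real where "0 < \<beta>" "\<beta> \<le> 1" "0 < z" "z \<le> 1" "3 * exp 1 * \<beta> / 2 \<le> z"
    "z powr \<delta> \<le> 1 / (3 * (exp 1)\<^sup>2)"
proof -
  let ?z = "(1 / (3 * (exp 1)\<^sup>2)) powr (1 / \<delta>) :: real"
  have e1: "(1::real) \<le> exp 1" by simp
  then have "1 \<le> (exp 1 :: real)\<^sup>2" by (rule one_le_power)
  then have "1 \<le> 3 * (exp 1 :: real)\<^sup>2" by linarith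
  then have "1 / (3 * (exp 1)\<^sup>2) \<le> (1 :: real)" by simp
  then have z1: "?z \<le> 1" using assms by (intro powr_le1) auto
  have z0: "?z > 0" by simp
  have zd: "?z powr \<delta> \<le> 1 / (3 * (exp 1)\<^sup>2)" using assms by (simp add: powr_powr)
  let ?b = "2 * ?z / (3 * exp 1) :: real"
  have b0: "0 < ?b" using z0 by simp
  have bz: "3 * exp 1 * ?b / 2 \<le> ?z" by simp
  have "2 * ?z \<le> 3 * exp 1" using z1 e1 by linarith
  then have b1: "?b \<le> 1" by (simp add: pos_divide_le_eq)
  show ?thesis by (rule that[OF b0 b1 z0 z1 bz zd])
qed

lemma star_threshold:
  fixes \<eta> :: real
  assumes "\<eta> > 0"
  obtains d :: nat where "d > 0" "3 ^ d / fact d \<le> \<eta>"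
proof -
  have "(\<lambda>d. inverse (fact d) * (3::real) ^ d) \<longlonglongrightarrow> 0"
    by (rule summable_LIMSEQ_zero[OF summable_exp])
  then have "\<forall>\<^sub>F d in sequentially. inverse (fact d) * (3::real) ^ d < \<eta>"
    using assms by (rule order_tendstoD)
  then have "\<forall>\<^sub>F d in sequentially. inverse (fact d) * (3::real) ^ d < \<eta> \<and> d > 0"
    using eventually_gt_at_top[of 0] by eventually_elim simp
  then obtain d where "inverse (fact d) * (3::real) ^ d < \<eta>" "d > 0"
    by (metis (no_types, lifting) eventually_happens sequentially_bot)
  then show ?thesis by (intro that[of d]) (simp_all add: field_simps)
qed

definition sparse_graph :: "real \<Rightarrow> real \<Rightarrow> nat \<Rightarrow> nat \<Rightarrow> nat set set \<Rightarrow> bool" where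
  "sparse_graph \<delta> \<beta> d n K \<longleftrightarrow> K \<subseteq> complete_edges n \<and> (1 + 2 * \<delta>) * real n \<le> real (card K) \<and>
    (\<forall>v<n. card {e \<in> K. v \<in> e} < d) \<and>
    (\<forall>W\<subseteq>{..<n}. W \<noteq> {} \<longrightarrow> real (card W) \<le> \<beta> * real n \<longrightarrow>
      real (card {e \<in> K. e \<subseteq> W}) < (1 + \<delta>) * real (card W))"

text \<open>The edge budget: about (1 + \<epsilon> / 2) * n expected edges, less \<epsilon> * n / 16
  for stars and 1 for dense sets, leaves (1 + \<epsilon> / 4) * n = (1 + 2 * \<delta>) * n.\<close>

lemma client_sparse_graph:
  fixes \<epsilon> \<beta> z :: real
  assumes \<epsilon>: "0 < \<epsilon>" "\<epsilon> < 1" and \<delta>: "\<delta> = \<epsilon> / 8" and d: "d > 0" "3 ^ d / fact d \<le> \<epsilon> / 16"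
    and \<beta>: "0 < \<beta>" and z: "0 < z" "z \<le> 1" "3 * exp 1 * \<beta> / 2 \<le> z"
    "z powr \<delta> \<le> 1 / (3 * (exp 1)\<^sup>2)" and n: "real n \<ge> 16 / \<epsilon>"
    and b: "real b \<le> (1 - \<epsilon>) * (real n / 2)"
  shows "client_can_achieve b (complete_edges n) (\<lambda>C. \<exists>K\<subseteq>C. sparse_graph \<delta> \<beta> d n K)"
proof -
  have \<delta>0: "\<delta> > 0" using \<delta> \<epsilon> by simp
  have n\<epsilon>: "16 \<le> n * \<epsilon>" using n \<epsilon> by (simp add: pos_divide_le_eq)
  have n0: "real n > 0" using n divide_pos_pos[of 16 \<epsilon>] \<epsilon> by linarith
  then have n1: "n \<ge> 1" by simp
  \<comment> \<open>The product (2 + \<epsilon>) * (1 - \<epsilon>) / 2 falls short of 1 by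
    \<epsilon> / 2 + \<epsilon>^2 / 2; the first part absorbs the +1 in
    \<open>b + 1\<close>.\<close>
  define p where "p = (2 + \<epsilon>) / n"
  have p: "0 \<le> p" "p \<le> 3 / n" using \<epsilon> n0 by (auto simp: p_def divide_right_mono)
  have "p * (real b + 1) \<le> p * ((1 - \<epsilon>) * (real n / 2) + 1)" using b p by (intro mult_left_mono) auto
  also have "\<dots> = (2 + \<epsilon>) * (1 - \<epsilon>) / 2 + (2 + \<epsilon>) / n" using n0 by (simp add: p_def field_simps)
  also have "\<dots> \<le> (2 + \<epsilon>) * (1 - \<epsilon>) / 2 + 3 / n" using \<epsilon> n0 by (simp add: divide_right_mono)
  also have "3 / n \<le> \<epsilon> / 2" using n\<epsilon> n0 by (simp add: field_simps)
  finally have "p * (real b + 1) \<le> 1 - \<epsilon> * \<epsilon> / 2" by (simp add: field_simps)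
  moreover have "\<epsilon> * \<epsilon> \<ge> 0" using \<epsilon> by simp
  ultimately have pb: "p * (real b + 1) \<le> 1" by linarith
  let ?X = "complete_edges n"
  let ?FF = "stars n d \<union> dense_sets \<delta> \<beta> n"
  have fs: "finite (stars n d)"
    unfolding stars_def by (auto simp: finite_imp_finite_nsets)
  have sub: "F \<subseteq> ?X" if "F \<in> ?FF" for F
    using that
  proof
    assume "F \<in> stars n d" then show ?thesis by (auto simp: stars_def star_def nsets_def)
  next
    assume "F \<in> dense_sets \<delta> \<beta> n"
    then obtain k W where "W \<in> nsets {..<n} k" "F \<in> nsets (nsets W 2) (nat \<lceil>(1 + \<delta>) * k\<rceil>)"
      unfolding dense_sets_def by blast
    then have "F \<subseteq> nsets W 2" "W \<subseteq> {..<n}" by (auto simp: nsets_def)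
    then show ?thesis using nsets_mono[of W "{..<n}" 2] by (auto simp: complete_edges_def)
  qed
  have fFF: "finite ?FF"
    by (rule finite_subset[of _ "Pow ?X"]) (use sub in auto)
  have ne: "{} \<notin> ?FF"
  proof
    assume "{} \<in> ?FF"
    then show False
    proof
      assume "{} \<in> stars n d" then show False using d by (auto simp: stars_def nsets_def)
    next
      assume "{} \<in> dense_sets \<delta> \<beta> n"
      then obtain k where k: "1 \<le> k" "nat \<lceil>(1 + \<delta>) * real k\<rceil> = 0"
        by (auto simp: dense_sets_def nsets_def)
      have "(1 + \<delta>) * real k > 0" using k \<delta>0 by simp
      then show False using k by linarith
    qed
  qed
  have "(\<Sum>F\<in>?FF. p ^ card F) \<le> (\<Sum>F\<in>stars n d. p ^ card F) + (\<Sum>F\<in>dense_sets \<delta> \<beta> n. p ^ card F)"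
    using fFF p by (subst sum_Un) (auto intro!: sum_nonneg)
  also have "\<dots> \<le> n * (\<epsilon> / 16) + 1"
  proof (rule add_mono)
    have "n * (3 ^ d / fact d) \<le> n * (\<epsilon> / 16)" using d by (intro mult_left_mono) auto
    then show "(\<Sum>F\<in>stars n d. p ^ card F) \<le> n * (\<epsilon> / 16)"
      using stars_sum[OF p n1, of d] by linarith
    show "(\<Sum>F\<in>dense_sets \<delta> \<beta> n. p ^ card F) \<le> 1"
      by (rule dense_sets_sum[OF n1 z(1-3) \<beta> z(4) \<delta>0 p])
  qed
  finally have S: "(\<Sum>F\<in>?FF. p ^ card F) \<le> n * (\<epsilon> / 16) + 1" .
  have cX: "real (card ?X) = real n * (real n - 1) / 2"
  proof -
    have dvd: "2 dvd n * (n - Suc 0)" by (cases "even n") auto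
    have "card ?X = n choose 2" by (simp add: complete_edges_def card_nsets)
    then have "2 * card ?X = n * (n - 1)" 
      by (simp add: choose_two dvd_mult_div_cancel[OF dvd])
    then have "real (2 * card ?X) = real (n * (n - 1))" by (simp only:)
    then show ?thesis using n1 by (simp add: of_nat_diff)
  qed
  have pX: "p * card ?X = (1 + \<epsilon> / 2) * (real n - 1)" unfolding cX using n0 by (simp add: p_def field_simps)
  show ?thesis
  proof (rule client_can_achieve_mono[OF client_avoids[OF finite_complete_edges fFF sub ne p(1) pb]])
    fix C assume "\<exists>K\<subseteq>C. K \<subseteq> ?X \<and> (\<forall>F\<in>?FF. \<not> F \<subseteq> K) \<and> p * card ?X \<le> card K + (\<Sum>F\<in>?FF. p ^ card F)"
    then obtain K where K: "K \<subseteq> C" "K \<subseteq> ?X" "\<forall>F\<in>?FF. \<not> F \<subseteq> K"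
      "p * card ?X \<le> card K + (\<Sum>F\<in>?FF. p ^ card F)" by blast
    \<comment> \<open>The slack 3 * \<epsilon> * n / 16 is at least 3 since \<epsilon> * n \<ge> 16,
      and covers the lower-order loss 2 + \<epsilon> / 2.\<close>
    have "(1 + \<epsilon> / 2) * (real n - 1) \<le> card K + (n * (\<epsilon> / 16) + 1)"
      using K(4) S unfolding pX by linarith
    then have "(1 + 2 * \<delta>) * n \<le> card K"
      using n\<epsilon> \<epsilon> unfolding \<delta> by (simp add: field_simps)
    moreover have "card {e \<in> K. v \<in> e} < d" if "v < n" for v
    proof (rule ccontr)
      assume "\<not> ?thesis"
      then obtain F where F: "F \<subseteq> {e \<in> K. v \<in> e}" "card F = d" "finite F"
        by (meson not_less obtain_subset_with_card_n)
      then have "F \<in> nsets (star n v) d" using K(2) by (auto simp: nsets_def star_def)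
      then have "F \<in> ?FF" using that by (auto simp: stars_def)
      then show False using K(3) F(1) by blast
    qed
    moreover have "card {e \<in> K. e \<subseteq> W} < (1 + \<delta>) * card W"
      if W: "W \<subseteq> {..<n}" "W \<noteq> {}" "card W \<le> \<beta> * n" for W
    proof (rule ccontr)
      assume "\<not> ?thesis"
      then have "nat \<lceil>(1 + \<delta>) * card W\<rceil> \<le> card {e \<in> K. e \<subseteq> W}" by linarith
      then obtain F where F: "F \<subseteq> {e \<in> K. e \<subseteq> W}" "card F = nat \<lceil>(1 + \<delta>) * card W\<rceil>" "finite F"
        by (meson obtain_subset_with_card_n)
      have fW: "finite W" using W(1) finite_subset by blast
      have "F \<subseteq> nsets W 2" using F(1) K(2) by (auto simp: nsets_def complete_edges_def)
      then have "F \<in> nsets (nsets W 2) (nat \<lceil>(1 + \<delta>) * card W\<rceil>)" using F by (auto simp: nsets_def)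
      moreover have "W \<in> nsets {..<n} (card W)" using W(1) fW by (auto simp: nsets_def)
      moreover have "1 \<le> card W" using W(2) fW by (simp add: Suc_le_eq card_gt_0_iff)
      ultimately have "F \<in> dense_sets \<delta> \<beta> n" using W(3) unfolding dense_sets_def by blast
      then show False using K(3) F(1) by blast
    qed
    ultimately show "\<exists>K\<subseteq>C. sparse_graph \<delta> \<beta> d n K"
      using K(1,2) unfolding sparse_graph_def by blast
  qed
qed

section \<open>Expanders in locally sparse graphs\<close>

lemma spans_connected_mono:
  assumes "spans_connected E S" "E \<subseteq> E'"
  shows "spans_connected E' S"
proof -
  have "{(u, v). u \<in> S \<and> v \<in> S \<and> {u, v} \<in> E} \<subseteq> {(u, v). u \<in> S \<and> v \<in> S \<and> {u, v} \<in> E'}"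
    using assms(2) by auto
  from rtrancl_mono[OF this] show ?thesis using assms(1) unfolding spans_connected_def by blast
qed

lemma has_minor_mono:
  assumes "has_minor V E W F" "V \<subseteq> V'" "E \<subseteq> E'"
  shows "has_minor V' E' W F"
proof -
  obtain B where B: "\<forall>u\<in>W. B u \<subseteq> V \<and> spans_connected E (B u)"
      "\<forall>u\<in>W. \<forall>v\<in>W. u \<noteq> v \<longrightarrow> B u \<inter> B v = {}"
      "\<forall>u\<in>W. \<forall>v\<in>W. {u, v} \<in> F \<longrightarrow> (\<exists>x\<in>B u. \<exists>y\<in>B v. {x, y} \<in> E)"
    using assms(1) unfolding has_minor_def by blast
  show ?thesis unfolding has_minor_def
  proof (intro exI[of _ B] conjI)
    show "\<forall>u\<in>W. B u \<subseteq> V' \<and> spans_connected E' (B u)"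
      using B(1) assms(2,3) spans_connected_mono by blast
    show "\<forall>u\<in>W. \<forall>v\<in>W. {u, v} \<in> F \<longrightarrow> (\<exists>x\<in>B u. \<exists>y\<in>B v. {x, y} \<in> E')"
      using B(3) assms(3) by blast
  qed (rule B(2))
qed

text \<open>An edge across has one end in each of the disjoint sets \<open>S\<close> and
  \<open>U - S\<close>, so the ordered pairs counted by \<open>edge_cut\<close> match the crossing
  edges one to one.\<close>

lemma card_edges_split:
  assumes K: "K \<subseteq> complete_edges n" and S: "S \<subseteq> U" and U: "finite U"
  shows "card {e \<in> K. e \<subseteq> U} = card {e \<in> K. e \<subseteq> S} + card {e \<in> K. e \<subseteq> U - S} + edge_cut K S (U - S)"
proof -
  have fK: "finite K" using K finite_subset by (metis finite_complete_edges)
  let ?P = "{(u, v). u \<in> S \<and> v \<in> U - S \<and> {u, v} \<in> K}"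
  let ?f = "\<lambda>(u, v). {u, v}"
  have inj: "inj_on ?f ?P" by (auto simp: inj_on_def doubleton_eq_iff)
  have fS: "finite S" using S U finite_subset by blast
  have c: "card (?f ` ?P) = edge_cut K S (U - S)" unfolding edge_cut_def by (rule card_image[OF inj])
  have eq: "{e \<in> K. e \<subseteq> U} = {e \<in> K. e \<subseteq> S} \<union> {e \<in> K. e \<subseteq> U - S} \<union> ?f ` ?P"
  proof
    show "{e \<in> K. e \<subseteq> U} \<subseteq> {e \<in> K. e \<subseteq> S} \<union> {e \<in> K. e \<subseteq> U - S} \<union> ?f ` ?P"
    proof
      fix e assume e: "e \<in> {e \<in> K. e \<subseteq> U}"
      then obtain x y where xy: "e = {x, y}"
        using K by (auto simp: complete_edges_def elim!: nsets2_E)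
      consider "x \<in> S" "y \<in> S" | "x \<in> S" "y \<notin> S" | "x \<notin> S" "y \<in> S" | "x \<notin> S" "y \<notin> S" by blast
      then show "e \<in> {e \<in> K. e \<subseteq> S} \<union> {e \<in> K. e \<subseteq> U - S} \<union> ?f ` ?P"
      proof cases
        case 2
        then have "(x, y) \<in> ?P" using e xy by auto
        then have "e \<in> ?f ` ?P" using xy by force
        then show ?thesis by blast
      next
        case 3
        then have "(y, x) \<in> ?P" using e xy by (auto simp: insert_commute)
        then have "e \<in> ?f ` ?P" using xy by force
        then show ?thesis by blast
      qed (use e xy in auto)
    qed
  qed (use S in auto)
  have "{} \<notin> K" using K by (auto simp: complete_edges_def nsets_def)
  then have d1: "{e \<in> K. e \<subseteq> S} \<inter> {e \<in> K. e \<subseteq> U - S} = {}" by (auto simp: subset_iff)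
  have d2: "({e \<in> K. e \<subseteq> S} \<union> {e \<in> K. e \<subseteq> U - S}) \<inter> ?f ` ?P = {}" by auto
  have fP: "finite ?P" by (rule finite_edge_cut) (use fS U in auto)
  have "card {e \<in> K. e \<subseteq> U} = card ({e \<in> K. e \<subseteq> S} \<union> {e \<in> K. e \<subseteq> U - S}) + card (?f ` ?P)"
    unfolding eq by (rule card_Un_disjoint) (use fK fP d2 in auto)
  also have "card ({e \<in> K. e \<subseteq> S} \<union> {e \<in> K. e \<subseteq> U - S}) = card {e \<in> K. e \<subseteq> S} + card {e \<in> K. e \<subseteq> U - S}"
    by (rule card_Un_disjoint) (use fK d1 in auto)
  finally show ?thesis using c by simp
qed

text \<open>A minimal set \<open>U\<close> spanning at least \<open>\<Psi> (card U)\<close> edges works, since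
  \<open>\<Psi> (x + y) = \<Psi> x + \<Psi> y + 2 * \<delta> * x * y / n\<close>.\<close>

lemma sparse_graph_expander:
  assumes K: "sparse_graph \<delta> \<beta> d n K" and \<delta>: "\<delta> > 0" and \<beta>: "\<beta> > 0" and n: "n \<ge> 1"
  obtains U where "U \<subseteq> {..<n}" "\<beta> * n < card U"
    "\<And>S. S \<subseteq> U \<Longrightarrow> 4 * card S \<le> 3 * card U \<Longrightarrow> \<delta> * \<beta> / 2 * card S \<le> edge_cut K S (U - S)"
proof -
  \<comment> \<open>It exceeds the local bound (1 + \<delta>) * x, so small sets cannot reach it,
    and equals (1 + 2 * \<delta>) * n at n, so the whole vertex set does. The quadratic term makes
    it superadditive.\<close>
  define \<Psi> where "\<Psi> = (\<lambda>x::real. (1 + \<delta>) * x + \<delta> * x\<^sup>2 / n)"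
  note K' = K[unfolded sparse_graph_def]
  let ?e = "\<lambda>U. real (card {e \<in> K. e \<subseteq> U})"
  define good where "good = (\<lambda>U. U \<subseteq> {..<n} \<and> U \<noteq> {} \<and> \<Psi> (card U) \<le> ?e U)"
  have "{e \<in> K. e \<subseteq> {..<n}} = K" using K' by (auto simp: complete_edges_def nsets_def)
  moreover have "\<Psi> n = (1 + 2 * \<delta>) * n" using n by (simp add: \<Psi>_def power2_eq_square algebra_simps)
  ultimately have "good {..<n}" using K' n by (auto simp: good_def lessThan_empty_iff)
  then obtain U where U: "good U" and min: "\<And>S. good S \<Longrightarrow> card U \<le> card S"
    using ex_has_least_nat[of good "{..<n}" card] by blast
  have Un: "U \<subseteq> {..<n}" and Une: "U \<noteq> {}" and Ue: "\<Psi> (card U) \<le> ?e U" using U by (auto simp: good_def)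
  have fU: "finite U" using Un finite_subset by blast
  have n0: "real n > 0" using n by simp
  have big: "\<beta> * n < card U"
  proof (rule ccontr)
    assume "\<not> ?thesis"
    then have "?e U < (1 + \<delta>) * card U" using K' Un Une by auto
    also have "\<dots> \<le> \<Psi> (card U)" using \<delta> by (simp add: \<Psi>_def)
    finally show False using Ue by simp
  qed
  have exp: "\<delta> * \<beta> / 2 * card S \<le> edge_cut K S (U - S)" if S: "S \<subseteq> U" "4 * card S \<le> 3 * card U" for S
  proof (cases "S = {}")
    case True then show ?thesis by (simp add: edge_cut_def)
  next
    case False
    have fS: "finite S" using S fU finite_subset by blast
    have cU: "card U > 0" using fU Une by (simp add: card_gt_0_iff)
    have cS: "card S > 0" using fS False by (simp add: card_gt_0_iff)
    have cD: "card (U - S) = card U - card S" using S fS by (simp add: card_Diff_subset)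
    have lt: "card S < card U" using S(2) cU by linarith
    have small: "?e W < \<Psi> (card W)" if "W \<subseteq> U" "W \<noteq> {}" "card W < card U" for W
      using min[of W] that Un unfolding good_def by force
    define x where "x = real (card S)"
    define y where "y = real (card (U - S))"
    have y: "real (card U) = x + y" "y \<ge> card U / 4"
      using cD lt S(2) by (auto simp: x_def y_def of_nat_diff)
    have "?e U = ?e S + ?e (U - S) + edge_cut K S (U - S)"
      using card_edges_split[of K n S U] K' S fU by simp
    moreover have "?e S < \<Psi> x" unfolding x_def by (rule small) (use S False lt in auto)
    moreover have "?e (U - S) < \<Psi> y"
    proof -
      have "card (U - S) < card U" "card (U - S) > 0" using cD lt cS by linarith+
      moreover from this have "U - S \<noteq> {}" by (metis card.empty less_irrefl)
      ultimately show ?thesis unfolding y_def by (intro small) auto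
    qed
    moreover have "\<Psi> (x + y) = \<Psi> x + \<Psi> y + 2 * \<delta> * x * y / n"
      using n0 by (simp add: \<Psi>_def power2_eq_square field_simps)
    ultimately have c: "2 * \<delta> * x * y / n \<le> edge_cut K S (U - S)" using Ue[unfolded y(1)] by linarith
    \<comment> \<open>The complement keeps a quarter of \<open>U\<close>, which is of linear size;
      the cross term then yields the expansion constant \<delta> * \<beta> / 2.\<close>
    have "\<beta> * n / 4 \<le> y" using y(2) big by linarith
    then have "2 * \<delta> * x * (\<beta> * n / 4) \<le> 2 * \<delta> * x * y" using \<delta> by (intro mult_left_mono) (auto simp: x_def)
    then have "2 * \<delta> * x * (\<beta> * n / 4) / n \<le> 2 * \<delta> * x * y / n" using n0 by (intro divide_right_mono) auto
    moreover have "2 * \<delta> * x * (\<beta> * n / 4) / n = \<delta> * \<beta> / 2 * x" using n0 by simp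
    ultimately show ?thesis using c unfolding x_def by linarith
  qed
  show ?thesis by (rule that[OF Un big exp])
qed

lemma sparse_graph_degree:
  assumes K: "sparse_graph \<delta> \<beta> d n K" and U: "U \<subseteq> {..<n}" and v: "v \<in> U"
  shows "card {u \<in> U. {u, v} \<in> K} \<le> d"
proof -
  note K' = K[unfolded sparse_graph_def]
  have fK: "finite K" using K' finite_subset finite_complete_edges by metis
  have "card {u \<in> U. {u, v} \<in> K} = card ((\<lambda>u. {u, v}) ` {u \<in> U. {u, v} \<in> K})"
    by (rule card_image[symmetric]) (auto simp: inj_on_def doubleton_eq_iff)
  also have "\<dots> \<le> card {e \<in> K. v \<in> e}" by (rule card_mono) (use fK in auto)
  also have "\<dots> < d" using K' U v by auto
  finally show ?thesis by simp
qed

theorem theorem5: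
  shows "\<forall>\<epsilon>::real. \<epsilon> > 0 \<longrightarrow>
    (\<exists>c::real. c > 0 \<and>
      (\<forall>\<^sub>F n::nat in sequentially. \<forall>b::nat. 1 \<le> b \<and> real b \<le> (1 - \<epsilon>) * (real n / 2) \<longrightarrow>
        client_can_achieve b (complete_edges n)
          (\<lambda>C. has_minor {..<n} C
                 {..<nat \<lfloor>c * sqrt (real n)\<rfloor>} (complete_edges (nat \<lfloor>c * sqrt (real n)\<rfloor>)))))"
proof (intro allI impI)
  fix \<epsilon> :: real assume \<epsilon>: "\<epsilon> > 0"
  show "\<exists>c>0. \<forall>\<^sub>F n::nat in sequentially. \<forall>b::nat. 1 \<le> b \<and> real b \<le> (1 - \<epsilon>) * (real n / 2) \<longrightarrow>
      client_can_achieve b (complete_edges n)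
        (\<lambda>C. has_minor {..<n} C
               {..<nat \<lfloor>c * sqrt (real n)\<rfloor>} (complete_edges (nat \<lfloor>c * sqrt (real n)\<rfloor>)))"
  proof (cases "\<epsilon> < 1")
    case False
    \<comment> \<open>For \<epsilon> \<ge> 1 no bias is admissible, and any \<open>c\<close> will
      do.\<close>
    have "\<not> (1 \<le> b \<and> real b \<le> (1 - \<epsilon>) * (real n / 2))" for b n :: nat
      using mult_nonpos_nonneg[of "1 - \<epsilon>" "real n / 2"] False by fastforce
    then show ?thesis by (intro exI[of _ 1] conjI always_eventually allI impI) (simp, blast)
  next
    case True
    define \<delta> where "\<delta> = \<epsilon> / 8"
    have \<delta>: "\<delta> > 0" using \<epsilon> by (simp add: \<delta>_def)
    obtain d where d: "d > 0" "3 ^ d / fact d \<le> \<epsilon> / 16"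
      using star_threshold[of "\<epsilon> / 16"] \<epsilon> by auto
    obtain \<beta> z where z: "0 < \<beta>" "\<beta> \<le> 1" "0 < z" "z \<le> 1" "3 * exp 1 * \<beta> / 2 \<le> z"
      "z powr \<delta> \<le> 1 / (3 * (exp 1)\<^sup>2)"
      using dense_threshold[OF \<delta>] by blast
    \<comment> \<open>Half of the expansion constant from \<open>sparse_graph_expander\<close>, as
      \<open>expander_minor\<close> asks for expansion \<open>2 * \<kappa>\<close>.\<close>
    define \<kappa> where "\<kappa> = \<delta> * \<beta> / 4"
    have \<kappa>: "\<kappa> > 0" using \<delta> z by (simp add: \<kappa>_def)
    have "\<delta> * \<beta> \<le> 1 * 1" using True z \<delta> by (intro mult_mono) (auto simp: \<delta>_def)
    then have \<kappa>d: "\<kappa> \<le> real d" using d by (simp add: \<kappa>_def)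
    obtain c n0 where c: "c > 0" and minor: "\<And>V (E :: nat set set) h. finite V \<Longrightarrow> n0 \<le> card V \<Longrightarrow>
        \<forall>v\<in>V. real (card {u \<in> V. {u, v} \<in> E}) \<le> real d \<Longrightarrow>
        \<forall>S\<subseteq>V. 4 * card S \<le> 3 * card V \<longrightarrow> 2 * \<kappa> * card S \<le> edge_cut E S (V - S) \<Longrightarrow>
        real h \<le> c * sqrt (card V) \<Longrightarrow> has_minor V E {..<h} (complete_edges h)"
      using expander_minor[OF \<kappa> \<kappa>d, where 'a = nat] by blast
    \<comment> \<open>The expander has only somewhat more than \<beta> * n vertices, which costs a
      factor sqrt \<beta>.\<close>
    define c' where "c' = c * sqrt \<beta>"
    have c': "c' > 0" using c z by (simp add: c'_def)
    have "\<forall>\<^sub>F n in sequentially. 16 / \<epsilon> \<le> real n \<and> real n0 / \<beta> \<le> real n \<and> 1 \<le> n"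
      by (intro eventually_conj eventually_ge_at_top filterlim_real_sequentially[THEN filterlim_at_top[THEN iffD1], rule_format])
    then have "\<forall>\<^sub>F n in sequentially. \<forall>b::nat. 1 \<le> b \<and> real b \<le> (1 - \<epsilon>) * (real n / 2) \<longrightarrow>
      client_can_achieve b (complete_edges n)
        (\<lambda>C. has_minor {..<n} C
               {..<nat \<lfloor>c' * sqrt (real n)\<rfloor>} (complete_edges (nat \<lfloor>c' * sqrt (real n)\<rfloor>)))"
    proof eventually_elim
      case (elim n)
      then have n: "16 / \<epsilon> \<le> real n" "real n0 \<le> \<beta> * n" "1 \<le> n"
        using z by (auto simp: pos_divide_le_eq mult.commute)
      show ?case
      proof (intro allI impI)
        fix b :: nat assume b: "1 \<le> b \<and> real b \<le> (1 - \<epsilon>) * (real n / 2)"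
        let ?h = "nat \<lfloor>c' * sqrt (real n)\<rfloor>"
        show "client_can_achieve b (complete_edges n) (\<lambda>C. has_minor {..<n} C {..<?h} (complete_edges ?h))"
        proof (rule client_can_achieve_mono)
          show "client_can_achieve b (complete_edges n) (\<lambda>C. \<exists>K\<subseteq>C. sparse_graph \<delta> \<beta> d n K)"
            by (rule client_sparse_graph[OF \<epsilon> True \<delta>_def d z(1) z(3-6) n(1)]) (use b in simp)
          fix C assume "\<exists>K\<subseteq>C. sparse_graph \<delta> \<beta> d n K"
          then obtain K where K: "K \<subseteq> C" "sparse_graph \<delta> \<beta> d n K" by blast
          obtain U where U: "U \<subseteq> {..<n}" "\<beta> * n < card U"
            "\<And>S. S \<subseteq> U \<Longrightarrow> 4 * card S \<le> 3 * card U \<Longrightarrow> \<delta> * \<beta> / 2 * card S \<le> edge_cut K S (U - S)"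
            using sparse_graph_expander[OF K(2) \<delta> z(1) n(3)] by blast
          have "has_minor U K {..<?h} (complete_edges ?h)"
          proof (rule minor)
            show "finite U" using U(1) finite_subset by blast
            show "n0 \<le> card U" using U(2) n(2) by linarith
            show "\<forall>v\<in>U. real (card {u \<in> U. {u, v} \<in> K}) \<le> real d"
              using sparse_graph_degree[OF K(2) U(1)] by simp
            have eq: "2 * \<kappa> = \<delta> * \<beta> / 2" by (simp add: \<kappa>_def)
            show "\<forall>S\<subseteq>U. 4 * card S \<le> 3 * card U \<longrightarrow> 2 * \<kappa> * card S \<le> edge_cut K S (U - S)"
              unfolding eq using U(3) by blast
            have "real ?h \<le> c' * sqrt n" using c' by (simp add: of_nat_floor)
            also have "\<dots> = c * sqrt (\<beta> * n)" by (simp add: c'_def real_sqrt_mult)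
            also have "\<dots> \<le> c * sqrt (card U)" using U(2) c by (intro mult_left_mono real_sqrt_le_mono) auto
            finally show "real ?h \<le> c * sqrt (card U)" .
          qed
          then show "has_minor {..<n} C {..<?h} (complete_edges ?h)"
            by (rule has_minor_mono[OF _ U(1) K(1)])
        qed
      qed
    qed
    with c' show ?thesis by blast
  qed
qed

end
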